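(* Let $G$ be a compact Lie group of dimension $n$, let $\triangle_1,\dots,\triangle_n\in\mathrm{diff}^1(\widehat G)$ be a strongly admissible selection of first order difference operators, and let $Q\in\mathrm{diff}^\ell(\widehat G)$ be an arbitrary difference operator of order $\ell$. Then for every $N\in\mathbb N$ $$Q=\sum_{\ell\le|\alpha|\le N-1}c_\alpha\triangle_\xi^\alpha+Q_N$$ for suitable constants $c_\alpha\in\mathbb C$ and a difference operator $Q_N\in\mathrm{diff}^N(\widehat G)$.
   Context: $G$ is a compact Lie group with unit element $e$. $\widehat G$ is the set of equivalence classes $[\xi]$ of continuous irreducible unitary representations of $G$, and $\widehat f(\xi)=\int_Gf(x)\xi(x)^*dx$, extended to distributions. A difference operator of order $k$ is an operator $Q$ of the form $Q\widehat f(\xi)=\widehat{qf}(\xi)$ with a (complex-valued) $q\in C^\infty(G)$ vanishing of order $k$ at $e$, i.e. $(Pq)(e)=0$ for all left-invariant differential operators $P$ of order $k-1$. The set of these is $\mathrm{diff}^k(\widehat G)$. A collection $\triangle_1,\dots,\triangle_n\in\mathrm{diff}^1(\widehat G)$ with functions $q_1,\dots,q_n$ is strongly admissible if $dq_j(e)\ne0$ for all $j$, $\operatorname{rank}(dq_1(e),\dots,dq_n(e))=n$ (over $\mathbb C$) and $\bigcap_j\{x\in G:q_j(x)=0\}=\{e\}$. $\triangle_\xi^\alpha=\triangle_1^{\alpha_1}\cdots\triangle_n^{\alpha_n}$ for $\alpha\in\mathbb N_0^n$. *)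

theory Defs
  imports
    "HOL-Analysis.Analysis"
    "HOL-Library.Function_Algebras"
    "Jordan_Normal_Form.Schur_Decomposition"
begin

text \<open>\<open>Ck_on\<close> and \<open>smooth_on\<close> are meant for open \<open>S\<close>.\<close>

primrec Ck_on ::
  "nat \<Rightarrow> 'a set \<Rightarrow> ('a::euclidean_space \<Rightarrow> 'b::real_normed_vector) \<Rightarrow> bool" where
  "Ck_on 0 S f \<longleftrightarrow> continuous_on S f"
| "Ck_on (Suc k) S f \<longleftrightarrow> (\<forall>x\<in>S. f differentiable (at x)) \<and>
     (\<forall>v. Ck_on k S (\<lambda>x. frechet_derivative f (at x) v))"

definition smooth_on :: "'a set \<Rightarrow> ('a::euclidean_space \<Rightarrow> 'b::real_normed_vector) \<Rightarrow> bool" where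
  "smooth_on S f \<longleftrightarrow> (\<forall>k. Ck_on k S f)"

text \<open>A chart is a pair \<open>(U, \<phi>)\<close>; only the values of \<open>\<phi>\<close> on \<open>U\<close> matter.\<close>

type_synonym ('m, 'e) chart = "'m set \<times> ('m \<Rightarrow> 'e)"

definition smooth_atlas ::
  "('m::t2_space, 'e::euclidean_space) chart set \<Rightarrow> bool" where
  "smooth_atlas A \<longleftrightarrow>
     (\<Union>(U, \<phi>)\<in>A. U) = UNIV \<and>
     (\<forall>(U, \<phi>)\<in>A. open U \<and> open (\<phi> ` U) \<and> homeomorphism U (\<phi> ` U) \<phi> (inv_into U \<phi>)) \<and>
     (\<forall>(U, \<phi>)\<in>A. \<forall>(V, \<psi>)\<in>A. smooth_on (\<phi> ` (U \<inter> V)) (\<psi> \<circ> inv_into U \<phi>))"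

definition smooth_map ::
  "('m::topological_space, 'e::euclidean_space) chart set \<Rightarrow>
   ('n::topological_space, 'f::euclidean_space) chart set \<Rightarrow> ('m \<Rightarrow> 'n) \<Rightarrow> bool" where
  "smooth_map A B F \<longleftrightarrow> continuous_on UNIV F \<and>
     (\<forall>(U, \<phi>)\<in>A. \<forall>(V, \<psi>)\<in>B. smooth_on (\<phi> ` (U \<inter> F -` V)) (\<psi> \<circ> F \<circ> inv_into U \<phi>))"

definition prod_atlas ::
  "('m, 'e) chart set \<Rightarrow> ('n, 'f) chart set \<Rightarrow> ('m \<times> 'n, 'e \<times> 'f) chart set" where
  "prod_atlas A B = {(U \<times> V, map_prod \<phi> \<psi>) | U \<phi> V \<psi>. (U, \<phi>) \<in> A \<and> (V, \<psi>) \<in> B}"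

text \<open>The group elements form a whole type, whose class provides the Hausdorff topology; the
  dimension of the Lie group is \<open>DIM('e)\<close>. Second countability follows from compactness.\<close>

record ('g, 'e) lie_group = "'g monoid" +
  atlas :: "('g, 'e) chart set"

definition compact_lie_group ::
  "('g::t2_space, 'e::euclidean_space) lie_group \<Rightarrow> bool" where
  "compact_lie_group G \<longleftrightarrow>
     group G \<and> carrier G = UNIV \<and> smooth_atlas (atlas G) \<and> compact (UNIV :: 'g set) \<and>
     smooth_map (prod_atlas (atlas G) (atlas G)) (atlas G) (\<lambda>(x, y). x \<otimes>\<^bsub>G\<^esub> y) \<and>
     smooth_map (atlas G) (atlas G) (\<lambda>x. inv\<^bsub>G\<^esub> x)"

definition smooth_functions ::
  "('g::t2_space, 'e::euclidean_space) lie_group \<Rightarrow> ('g \<Rightarrow> complex) set" where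
  "smooth_functions G = {f. \<forall>(U, \<phi>)\<in>atlas G. smooth_on (\<phi> ` U) (f \<circ> inv_into U \<phi>)}"

primrec iterated_deriv ::
  "'a list \<Rightarrow> ('a::euclidean_space \<Rightarrow> complex) \<Rightarrow> 'a \<Rightarrow> complex" where
  "iterated_deriv [] f = f"
| "iterated_deriv (v # vs) f = (\<lambda>x. frechet_derivative (iterated_deriv vs f) (at x) v)"

definition basis_words :: "nat \<Rightarrow> 'e::euclidean_space list set" where
  "basis_words m = {vs. set vs \<subseteq> Basis \<and> length vs \<le> m}"

text \<open>Differential operators of order at most \<open>m\<close> with smooth complex coefficients. The local
  expression runs over words of coordinate directions rather than over multi-indices; partial
  derivatives of smooth functions commute, so this only makes the coefficients non-unique. Only
  the restriction of the operator to smooth functions is relevant.\<close>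

definition diff_operators ::
  "('g::t2_space, 'e::euclidean_space) lie_group \<Rightarrow> nat \<Rightarrow>
   (('g \<Rightarrow> complex) \<Rightarrow> 'g \<Rightarrow> complex) set" where
  "diff_operators G m = {P.
     (\<forall>f\<in>smooth_functions G. P f \<in> smooth_functions G) \<and>
     (\<forall>(U, \<phi>)\<in>atlas G. \<exists>a.
        (\<forall>vs\<in>basis_words m. smooth_on (\<phi> ` U) (a vs)) \<and>
        (\<forall>f\<in>smooth_functions G. \<forall>x\<in>U.
           P f x = (\<Sum>vs\<in>basis_words m.
             a vs (\<phi> x) * iterated_deriv vs (f \<circ> inv_into U \<phi>) (\<phi> x))))}"

definition left_invariant_diff_operators ::
  "('g::t2_space, 'e::euclidean_space) lie_group \<Rightarrow> nat \<Rightarrow>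
   (('g \<Rightarrow> complex) \<Rightarrow> 'g \<Rightarrow> complex) set" where
  "left_invariant_diff_operators G m = {P \<in> diff_operators G m.
     \<forall>g. \<forall>f\<in>smooth_functions G. P (\<lambda>x. f (g \<otimes>\<^bsub>G\<^esub> x)) = (\<lambda>x. P f (g \<otimes>\<^bsub>G\<^esub> x))}"

text \<open>For \<open>k \<ge> 1\<close> the bound \<open>m < k\<close> says order at most \<open>k - 1\<close>; for \<open>k = 0\<close> there is no
  condition besides smoothness.\<close>

definition vanishes_of_order ::
  "('g::t2_space, 'e::euclidean_space) lie_group \<Rightarrow> nat \<Rightarrow> ('g \<Rightarrow> complex) \<Rightarrow> bool" where
  "vanishes_of_order G k q \<longleftrightarrow> q \<in> smooth_functions G \<and>
     (\<forall>m<k. \<forall>P\<in>left_invariant_diff_operators G m. P q \<one>\<^bsub>G\<^esub> = 0)"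

type_synonym 'g matrix_rep = "'g \<Rightarrow> complex mat"

definition rep_dim :: "('g, 'e) lie_group \<Rightarrow> 'g matrix_rep \<Rightarrow> nat" where
  "rep_dim G \<xi> = dim_row (\<xi> \<one>\<^bsub>G\<^esub>)"

definition unitary_rep ::
  "('g::topological_space, 'e) lie_group \<Rightarrow> 'g matrix_rep \<Rightarrow> bool" where
  "unitary_rep G \<xi> \<longleftrightarrow> (let d = rep_dim G \<xi> in
     (\<forall>x. \<xi> x \<in> carrier_mat d d \<and> \<xi> x * mat_adjoint (\<xi> x) = 1\<^sub>m d) \<and>
     (\<forall>x y. \<xi> (x \<otimes>\<^bsub>G\<^esub> y) = \<xi> x * \<xi> y) \<and>
     (\<forall>i<d. \<forall>j<d. continuous_on UNIV (\<lambda>x. \<xi> x $$ (i, j))))"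

definition irreducible_rep :: "('g, 'e) lie_group \<Rightarrow> 'g matrix_rep \<Rightarrow> bool" where
  "irreducible_rep G \<xi> \<longleftrightarrow> (let d = rep_dim G \<xi> in
     d > 0 \<and>
     (\<forall>W. W \<subseteq> carrier_vec d \<and> 0\<^sub>v d \<in> W \<and>
          (\<forall>v\<in>W. \<forall>w\<in>W. v + w \<in> W) \<and> (\<forall>c. \<forall>v\<in>W. c \<cdot>\<^sub>v v \<in> W) \<and>
          (\<forall>x. \<forall>v\<in>W. \<xi> x *\<^sub>v v \<in> W)
        \<longrightarrow> W = {0\<^sub>v d} \<or> W = carrier_vec d))"

definition irreps :: "('g::topological_space, 'e) lie_group \<Rightarrow> 'g matrix_rep set" where
  "irreps G = {\<xi>. unitary_rep G \<xi> \<and> irreducible_rep G \<xi>}"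

definition equivalent_reps ::
  "('g, 'e) lie_group \<Rightarrow> 'g matrix_rep \<Rightarrow> 'g matrix_rep \<Rightarrow> bool" where
  "equivalent_reps G \<xi> \<eta> \<longleftrightarrow> rep_dim G \<xi> = rep_dim G \<eta> \<and>
     (\<exists>T\<in>carrier_mat (rep_dim G \<xi>) (rep_dim G \<xi>). invertible_mat T \<and>
        (\<forall>x. T * \<xi> x = \<eta> x * T))"

definition unitary_dual ::
  "('g::topological_space, 'e) lie_group \<Rightarrow> 'g matrix_rep set set" where
  "unitary_dual G =
     irreps G // {(\<xi>, \<eta>). \<xi> \<in> irreps G \<and> \<eta> \<in> irreps G \<and> equivalent_reps G \<xi> \<eta>}"

text \<open>As usual, one representative is fixed in every class.\<close>

definition repr :: "'g matrix_rep set \<Rightarrow> 'g matrix_rep" where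
  "repr \<kappa> = (SOME \<xi>. \<xi> \<in> \<kappa>)"

text \<open>A distribution is a linear functional that is continuous on smooth functions, where smooth
  functions carry the topology of the seminorms \<open>f \<mapsto> sup |P f|\<close> for differential operators \<open>P\<close>.
  HOL functions are total, so a distribution is represented by any linear extension to the space
  of all functions. Every functional on the subspace of smooth functions has such an extension,
  and its choice has no influence on Fourier coefficients, because the matrix entries of a
  continuous finite-dimensional representation of a Lie group are smooth.\<close>

definition distributions ::
  "('g::t2_space, 'e::euclidean_space) lie_group \<Rightarrow> (('g \<Rightarrow> complex) \<Rightarrow> complex) set" where
  "distributions G = {u.
     (\<forall>a b f g. u (\<lambda>x. a * f x + b * g x) = a * u f + b * u g) \<and>
     (\<exists>Ps C. set Ps \<subseteq> (\<Union>m. diff_operators G m) \<and>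
        (\<forall>f\<in>smooth_functions G. norm (u f) \<le> C * (\<Sum>P\<leftarrow>Ps. SUP x. norm (P f x))))}"

definition mult_distribution ::
  "('g \<Rightarrow> complex) \<Rightarrow> (('g \<Rightarrow> complex) \<Rightarrow> complex) \<Rightarrow> ('g \<Rightarrow> complex) \<Rightarrow> complex" where
  "mult_distribution q u = (\<lambda>f. u (\<lambda>x. q x * f x))"

text \<open>The value at a class \<open>[\<xi>]\<close> is the matrix obtained by applying \<open>u\<close> to the entries of
  \<open>x \<mapsto> \<xi>(x)\<^sup>*\<close>. If \<open>u\<close> is given by a function \<open>f\<close>, i.e. \<open>u g = \<integral> f g\<close> for smooth \<open>g\<close> and
  normalised Haar measure, then this is the matrix \<open>\<integral> f(x) \<xi>(x)\<^sup>* dx\<close>.\<close>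

type_synonym 'g dual_field = "'g matrix_rep set \<Rightarrow> complex mat"

definition fourier ::
  "('g::t2_space, 'e::euclidean_space) lie_group \<Rightarrow> (('g \<Rightarrow> complex) \<Rightarrow> complex) \<Rightarrow>
   'g dual_field" where
  "fourier G u = (\<lambda>\<kappa>\<in>unitary_dual G.
     mat (rep_dim G (repr \<kappa>)) (rep_dim G (repr \<kappa>))
       (\<lambda>(i, j). u (\<lambda>x. mat_adjoint (repr \<kappa> x) $$ (i, j))))"

text \<open>Operators act on the Fourier transforms of distributions; their values on other fields are
  irrelevant.\<close>

definition difference_operator ::
  "('g::t2_space, 'e::euclidean_space) lie_group \<Rightarrow> ('g \<Rightarrow> complex) \<Rightarrow>
   ('g dual_field \<Rightarrow> 'g dual_field) \<Rightarrow> bool" where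
  "difference_operator G q Q \<longleftrightarrow>
     (\<forall>u\<in>distributions G. Q (fourier G u) = fourier G (mult_distribution q u))"

definition diff_ops ::
  "('g::t2_space, 'e::euclidean_space) lie_group \<Rightarrow> nat \<Rightarrow>
   ('g dual_field \<Rightarrow> 'g dual_field) set" where
  "diff_ops G k = {Q. \<exists>q. vanishes_of_order G k q \<and> difference_operator G q Q}"

text \<open>The complex-valued differential \<open>dq(p)\<close>, an element of the complexified cotangent space,
  in a chart around \<open>p\<close>.\<close>

definition differential_in ::
  "('g, 'e::euclidean_space) chart \<Rightarrow> ('g \<Rightarrow> complex) \<Rightarrow> 'g \<Rightarrow> 'e \<Rightarrow> complex" where
  "differential_in c q p =
     (case c of (U, \<phi>) \<Rightarrow> frechet_derivative (q \<circ> inv_into U \<phi>) (at (\<phi> p)))"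

definition strongly_admissible ::
  "('g::t2_space, 'e::euclidean_space) lie_group \<Rightarrow> nat \<Rightarrow>
   (nat \<Rightarrow> 'g dual_field \<Rightarrow> 'g dual_field) \<Rightarrow> (nat \<Rightarrow> 'g \<Rightarrow> complex) \<Rightarrow> bool" where
  "strongly_admissible G n \<Delta> q \<longleftrightarrow>
     (\<forall>j<n. vanishes_of_order G 1 (q j) \<and> difference_operator G (q j) (\<Delta> j)) \<and>
     (\<forall>c\<in>atlas G. \<one>\<^bsub>G\<^esub> \<in> fst c \<longrightarrow>
        (\<forall>j<n. differential_in c (q j) \<one>\<^bsub>G\<^esub> \<noteq> (\<lambda>v. 0)) \<and>
        vector_space.dim (\<lambda>(a::complex) f v. a * f v)
          ((\<lambda>j. differential_in c (q j) \<one>\<^bsub>G\<^esub>) ` {..<n}) = n) \<and>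
     (\<Inter>j<n. {x. q j x = 0}) = {\<one>\<^bsub>G\<^esub>}"

text \<open>\<open>op_power n \<Delta> \<alpha> = (\<Delta> 0 ^^ \<alpha> 0) \<circ> \<dots> \<circ> (\<Delta> (n-1) ^^ \<alpha> (n-1))\<close>; families are indexed from \<open>0\<close>.\<close>

definition op_power ::
  "nat \<Rightarrow> (nat \<Rightarrow> 'a \<Rightarrow> 'a) \<Rightarrow> (nat \<Rightarrow> nat) \<Rightarrow> 'a \<Rightarrow> 'a" where
  "op_power n \<Delta> \<alpha> = foldr (\<lambda>j F. (\<Delta> j ^^ \<alpha> j) \<circ> F) [0..<n] id"

text \<open>For \<open>N \<ge> 1\<close> the last condition is \<open>|\<alpha>| \<le> N - 1\<close>; truncated subtraction would admit
  \<open>\<alpha> = 0\<close> for \<open>N = 0\<close>.\<close>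

definition multi_indices :: "nat \<Rightarrow> nat \<Rightarrow> nat \<Rightarrow> (nat \<Rightarrow> nat) set" where
  "multi_indices n l N =
     {\<alpha>. (\<forall>j\<ge>n. \<alpha> j = 0) \<and> l \<le> (\<Sum>j<n. \<alpha> j) \<and> (\<Sum>j<n. \<alpha> j) < N}"

end

theory Submission
  imports Defs
begin

text \<open>A difference operator is multiplication by a smooth function on the group side, so the
  expansion of \<open>Q\<close> is a Taylor expansion of its function \<open>q\<close> at the unit element in powers of
  \<open>q\<^sub>1, \<dots>, q\<^sub>n\<close>. In a chart around \<open>e\<close>, strong admissibility says that the coordinates are linear
  combinations of the \<open>q\<^sub>j\<close> up to terms vanishing to second order. If \<open>f\<close> vanishes to order \<open>k\<close> at
  \<open>p\<close>, then Euler's identity gives \<open>k f(x) = \<Sum>\<^sub>i (x - p)\<^sub>i \<partial>\<^sub>i f(x)\<close> up to order \<open>k + 1\<close>; since the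
  \<open>\<partial>\<^sub>i f\<close> vanish to order \<open>k - 1\<close>, induction on \<open>k\<close> turns the leading part of \<open>f\<close> into a homogeneous
  polynomial in the \<open>q\<^sub>j\<close>. Vanishing of all coordinate derivatives below order \<open>k\<close> is the same as
  vanishing under all left-invariant operators below order \<open>k\<close>, because every coordinate derivative
  at \<open>e\<close> can be translated to a left-invariant operator. Finally \<open>Q\<^sub>N\<close> is defined as the difference,
  so injectivity of the Fourier transform is not needed.\<close>

no_notation scalar_prod (infix "\<bullet>" 70)

section \<open>Smooth functions on Euclidean spaces\<close>

abbreviation partial :: "'a::real_normed_vector \<Rightarrow> ('a \<Rightarrow> 'b::real_normed_vector) \<Rightarrow> 'a \<Rightarrow> 'b" where
  "partial v f \<equiv> (\<lambda>x. frechet_derivative f (at x) v)"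

lemma frechet_derivative_cong_open:
  assumes "open S" "x \<in> S" "\<And>y. y \<in> S \<Longrightarrow> f y = g y"
  shows "frechet_derivative f (at x) = frechet_derivative g (at x)"
proof -
  have "(f has_derivative D) (at x) \<longleftrightarrow> (g has_derivative D) (at x)" for D
    using has_derivative_transform_within_open[OF _ assms(1,2)] assms(3) by metis
  then show ?thesis
    unfolding frechet_derivative_def by simp
qed

lemma differentiable_cong_open:
  assumes "open S" "x \<in> S" "\<And>y. y \<in> S \<Longrightarrow> f y = g y" "f differentiable (at x)"
  shows "g differentiable (at x)"
  using assms unfolding differentiable_def
  using has_derivative_transform_within_open[OF _ assms(1,2)] by blast

lemma Ck_on_cong:
  assumes "open S" "\<And>x. x \<in> S \<Longrightarrow> f x = g x" "Ck_on k S f"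
  shows "Ck_on k S g"
  using assms(2,3)
proof (induction k arbitrary: f g)
  case 0
  then show ?case by (simp cong: continuous_on_cong)
next
  case (Suc k)
  have "g differentiable (at x)" if "x \<in> S" for x
    using differentiable_cong_open[OF assms(1) that Suc.prems(1)] Suc.prems(2) that by simp
  moreover have "Ck_on k S (partial v g)" for v
    by (rule Suc.IH[where f = "partial v f"])
      (use Suc.prems frechet_derivative_cong_open[OF assms(1) _ Suc.prems(1)] in auto)
  ultimately show ?case by simp
qed

lemma Ck_on_subset: "Ck_on k S f \<Longrightarrow> T \<subseteq> S \<Longrightarrow> Ck_on k T f"
  by (induction k arbitrary: f) (auto intro: continuous_on_subset)

lemma Ck_on_Suc_imp: "Ck_on (Suc k) S f \<Longrightarrow> Ck_on k S f"
proof (induction k arbitrary: f)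
  case 0
  then show ?case
    by (auto intro!: continuous_at_imp_continuous_on differentiable_imp_continuous_within)
next
  case (Suc k)
  have "Ck_on (Suc k) S (partial v f)" for v
    using Suc.prems unfolding Ck_on.simps(2)[of "Suc k"] by blast
  then have "Ck_on k S (partial v f)" for v
    by (rule Suc.IH)
  then show ?case using Suc.prems by simp
qed

lemma Ck_on_const: "Ck_on k S (\<lambda>x. c)"
  by (induction k arbitrary: c) auto

lemma frechet_derivative_bounded_linear_comp:
  assumes "bounded_linear h" "f differentiable (at x)"
  shows "frechet_derivative (\<lambda>x. h (f x)) (at x) = (\<lambda>v. h (frechet_derivative f (at x) v))"
  using bounded_linear.has_derivative[OF assms(1) assms(2)[unfolded frechet_derivative_works]]
  by (rule frechet_derivative_at[symmetric])

lemma Ck_on_bounded_linear_comp: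
  assumes "open S" "bounded_linear h" "Ck_on k S f"
  shows "Ck_on k S (\<lambda>x. h (f x))"
  using assms(3)
proof (induction k arbitrary: f)
  case 0
  then show ?case
    using assms(2) by (simp add: bounded_linear.continuous_on)
next
  case (Suc k)
  have "(\<lambda>x. h (f x)) differentiable (at x)" if "x \<in> S" for x
  proof -
    have "(f has_derivative frechet_derivative f (at x)) (at x)"
      using Suc.prems that by (simp_all add: frechet_derivative_works[symmetric])
    from bounded_linear.has_derivative[OF assms(2) this] show ?thesis
      unfolding differentiable_def by blast
  qed
  moreover have "Ck_on k S (partial v (\<lambda>x. h (f x)))" for v
    by (rule Ck_on_cong[OF assms(1) _ Suc.IH[of "partial v f"]])
      (use Suc.prems in \<open>auto simp: frechet_derivative_bounded_linear_comp[OF assms(2)]\<close>)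
  ultimately show ?case by simp
qed

lemma frechet_derivative_add:
  assumes "f differentiable (at x)" "g differentiable (at x)"
  shows "frechet_derivative (\<lambda>x. f x + g x) (at x) =
    (\<lambda>v. frechet_derivative f (at x) v + frechet_derivative g (at x) v)"
  by (rule frechet_derivative_at[symmetric])
    (use assms in \<open>auto intro!: has_derivative_add simp: frechet_derivative_works\<close>)

lemma Ck_on_add:
  assumes "open S" "Ck_on k S f" "Ck_on k S g"
  shows "Ck_on k S (\<lambda>x. f x + g x)"
  using assms(2,3)
proof (induction k arbitrary: f g)
  case 0
  then show ?case by (simp add: continuous_on_add)
next
  case (Suc k)
  have "Ck_on k S (partial v (\<lambda>x. f x + g x))" for v
    by (rule Ck_on_cong[OF assms(1) _ Suc.IH[of "partial v f" "partial v g"]])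
      (use Suc.prems in \<open>auto simp: frechet_derivative_add\<close>)
  then show ?case using Suc.prems by (auto intro!: differentiable_add)
qed

lemma frechet_derivative_bilinear:
  assumes "bounded_bilinear B" "f differentiable (at x)" "g differentiable (at x)"
  shows "frechet_derivative (\<lambda>x. B (f x) (g x)) (at x) =
    (\<lambda>v. B (f x) (frechet_derivative g (at x) v) + B (frechet_derivative f (at x) v) (g x))"
  using bounded_bilinear.FDERIV[OF assms(1)
      assms(2)[unfolded frechet_derivative_works] assms(3)[unfolded frechet_derivative_works]]
  by (rule frechet_derivative_at[symmetric])

lemma Ck_on_bilinear:
  assumes "open S" "bounded_bilinear B" "Ck_on k S f" "Ck_on k S g"
  shows "Ck_on k S (\<lambda>x. B (f x) (g x))"
  using assms(3,4)
proof (induction k arbitrary: f g)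
  case 0
  then show ?case using assms(2) by (simp add: bounded_bilinear.continuous_on)
next
  case (Suc k)
  have "(\<lambda>x. B (f x) (g x)) differentiable (at x)" if "x \<in> S" for x
  proof -
    have "(f has_derivative frechet_derivative f (at x)) (at x)"
      "(g has_derivative frechet_derivative g (at x)) (at x)"
      using Suc.prems that by (simp_all add: frechet_derivative_works[symmetric])
    from bounded_bilinear.FDERIV[OF assms(2) this] show ?thesis
      unfolding differentiable_def by blast
  qed
  moreover have "Ck_on k S (partial v (\<lambda>x. B (f x) (g x)))" for v
  proof (rule Ck_on_cong[OF assms(1)])
    show "Ck_on k S (\<lambda>x. B (f x) (partial v g x) + B (partial v f x) (g x))"
      using Suc.prems Suc.prems[THEN Ck_on_Suc_imp] by (intro Ck_on_add assms(1) Suc.IH) simp_all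
  qed (use Suc.prems in \<open>auto simp: frechet_derivative_bilinear[OF assms(2)]\<close>)
  ultimately show ?case by simp
qed

lemma Ck_on_sum:
  assumes "open S" "\<And>i. i \<in> I \<Longrightarrow> Ck_on k S (f i)"
  shows "Ck_on k S (\<lambda>x. \<Sum>i\<in>I. f i x)"
  using assms(2)
  by (induction I rule: infinite_finite_induct) (auto intro: Ck_on_add[OF assms(1)] Ck_on_const)

lemma frechet_derivative_comp_Basis:
  fixes g :: "'a::euclidean_space \<Rightarrow> 'b::euclidean_space"
  assumes "g differentiable (at x)" "f differentiable (at (g x))"
  shows "frechet_derivative (\<lambda>x. f (g x)) (at x) v =
    (\<Sum>b\<in>Basis. (partial v g x \<bullet> b) *\<^sub>R partial b f (g x))"
proof -
  let ?D = "frechet_derivative f (at (g x))"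
  have "frechet_derivative (f \<circ> g) (at x) = ?D \<circ> frechet_derivative g (at x)"
    by (rule frechet_derivative_compose[OF assms])
  then have "frechet_derivative (\<lambda>x. f (g x)) (at x) v = ?D (partial v g x)"
    by (simp add: o_def)
  also have "\<dots> = ?D (\<Sum>b\<in>Basis. (partial v g x \<bullet> b) *\<^sub>R b)"
    by (simp add: euclidean_representation)
  also have "\<dots> = (\<Sum>b\<in>Basis. (partial v g x \<bullet> b) *\<^sub>R ?D b)"
    using linear_frechet_derivative[OF assms(2)] by (simp add: linear_sum linear_scale)
  finally show ?thesis .
qed

lemma Ck_on_comp:
  fixes g :: "'a::euclidean_space \<Rightarrow> 'b::euclidean_space"
  assumes "open T" "open S" "Ck_on k T g" "g ` T \<subseteq> S" "Ck_on k S f"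
  shows "Ck_on k T (\<lambda>x. f (g x))"
  using assms(3,5)
proof (induction k arbitrary: f)
  case 0
  then show ?case using continuous_on_compose2[OF _ _ assms(4), of f] by simp
next
  case (Suc k)
  have diff: "g differentiable (at x)" "f differentiable (at (g x))" if "x \<in> T" for x
    using Suc.prems that assms(4) by auto
  have "(\<lambda>x. f (g x)) differentiable (at x)" if "x \<in> T" for x
    using differentiable_chain_at[OF diff[OF that]] by (simp add: o_def)
  moreover have "Ck_on k T (partial v (\<lambda>x. f (g x)))" for v
  proof (rule Ck_on_cong[OF assms(1)])
    have "Ck_on k T (partial v g)" "Ck_on k T (\<lambda>x. partial b f (g x))" for b
      using Suc.prems Suc.IH[OF Suc.prems(1)[THEN Ck_on_Suc_imp], of "partial b f"] by simp_all
    then show "Ck_on k T (\<lambda>x. \<Sum>b\<in>Basis. (partial v g x \<bullet> b) *\<^sub>R partial b f (g x))"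
      by (intro Ck_on_sum[OF assms(1)] Ck_on_bilinear[OF assms(1) bounded_bilinear_scaleR]
          Ck_on_bounded_linear_comp[OF assms(1) bounded_linear_inner_left])
  next
    fix x assume "x \<in> T"
    from frechet_derivative_comp_Basis[OF diff[OF this]]
    show "(\<Sum>b\<in>Basis. (partial v g x \<bullet> b) *\<^sub>R partial b f (g x)) = partial v (\<lambda>x. f (g x)) x"
      by simp
  qed
  ultimately show ?case by simp
qed

lemma smooth_on_cong:
  assumes "open S" "\<And>x. x \<in> S \<Longrightarrow> f x = g x" "smooth_on S f"
  shows "smooth_on S g"
  using assms(3) Ck_on_cong[OF assms(1,2)] unfolding smooth_on_def by simp

lemma smooth_on_subset: "smooth_on S f \<Longrightarrow> T \<subseteq> S \<Longrightarrow> smooth_on T f"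
  by (simp add: smooth_on_def Ck_on_subset[of _ S])

lemma smooth_on_const: "smooth_on S (\<lambda>x. c)"
  by (simp add: smooth_on_def Ck_on_const)

lemma smooth_on_bounded_linear_comp:
  "open S \<Longrightarrow> bounded_linear h \<Longrightarrow> smooth_on S f \<Longrightarrow> smooth_on S (\<lambda>x. h (f x))"
  by (simp add: smooth_on_def Ck_on_bounded_linear_comp)

lemma smooth_on_add:
  "open S \<Longrightarrow> smooth_on S f \<Longrightarrow> smooth_on S g \<Longrightarrow> smooth_on S (\<lambda>x. f x + g x)"
  by (simp add: smooth_on_def Ck_on_add)

lemma smooth_on_diff:
  fixes f g :: "'a::euclidean_space \<Rightarrow> 'b::real_normed_vector"
  assumes "open S" "smooth_on S f" "smooth_on S g"
  shows "smooth_on S (\<lambda>x. f x - g x)"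
  using smooth_on_add[OF assms(1,2) smooth_on_bounded_linear_comp[OF assms(1)
        bounded_linear_minus[OF bounded_linear_ident] assms(3)]] by simp

lemma smooth_on_sum:
  "open S \<Longrightarrow> (\<And>i. i \<in> I \<Longrightarrow> smooth_on S (f i)) \<Longrightarrow> smooth_on S (\<lambda>x. \<Sum>i\<in>I. f i x)"
  by (simp add: smooth_on_def Ck_on_sum)

lemma smooth_on_mult:
  fixes f g :: "'a::euclidean_space \<Rightarrow> 'b::real_normed_algebra"
  shows "open S \<Longrightarrow> smooth_on S f \<Longrightarrow> smooth_on S g \<Longrightarrow> smooth_on S (\<lambda>x. f x * g x)"
  by (simp add: smooth_on_def Ck_on_bilinear[OF _ bounded_bilinear_mult])

lemma smooth_on_power:
  fixes f :: "'a::euclidean_space \<Rightarrow> 'b::real_normed_algebra_1"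
  shows "open S \<Longrightarrow> smooth_on S f \<Longrightarrow> smooth_on S (\<lambda>x. f x ^ m)"
  by (induction m) (simp_all add: smooth_on_const smooth_on_mult)

lemma smooth_on_prod:
  fixes f :: "'i \<Rightarrow> 'a::euclidean_space \<Rightarrow> 'b::real_normed_field"
  shows "open S \<Longrightarrow> (\<And>i. i \<in> I \<Longrightarrow> smooth_on S (f i)) \<Longrightarrow> smooth_on S (\<lambda>x. \<Prod>i\<in>I. f i x)"
  by (induction I rule: infinite_finite_induct) (simp_all add: smooth_on_const smooth_on_mult)

lemma smooth_on_comp:
  fixes g :: "'a::euclidean_space \<Rightarrow> 'b::euclidean_space"
  shows "open T \<Longrightarrow> open S \<Longrightarrow> smooth_on T g \<Longrightarrow> g ` T \<subseteq> S \<Longrightarrow> smooth_on S f \<Longrightarrow>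
    smooth_on T (\<lambda>x. f (g x))"
  unfolding smooth_on_def by (rule allI, rule Ck_on_comp[of T S]) simp_all

lemma smooth_on_partial: "smooth_on S f \<Longrightarrow> smooth_on S (partial v f)"
  unfolding smooth_on_def
proof
  fix k assume "\<forall>k. Ck_on k S f"
  then have "Ck_on (Suc k) S f" ..
  then show "Ck_on k S (partial v f)" by simp
qed

lemma smooth_on_differentiable:
  assumes "smooth_on S f" "x \<in> S"
  shows "f differentiable (at x)"
proof -
  have "Ck_on (Suc 0) S f"
    using assms(1) unfolding smooth_on_def ..
  then show ?thesis using assms(2) by simp
qed

lemma smooth_on_continuous:
  assumes "smooth_on S f"
  shows "continuous_on S f"
proof -
  have "Ck_on 0 S f"
    using assms unfolding smooth_on_def ..
  then show ?thesis by simp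
qed

lemma smooth_on_iterated_deriv: "smooth_on S f \<Longrightarrow> smooth_on S (iterated_deriv vs f)"
  by (induction vs) (simp_all add: smooth_on_partial)

lemma smooth_on_ident: "smooth_on S (\<lambda>x. x)"
proof -
  have "Ck_on k S (\<lambda>x. x)" for k
    by (cases k) (simp_all add: Ck_on_const)
  then show ?thesis by (simp add: smooth_on_def)
qed

lemma smooth_on_affine:
  assumes "open S" "bounded_linear h"
  shows "smooth_on S (\<lambda>x. h x + c)"
  by (rule smooth_on_add[OF assms(1) smooth_on_bounded_linear_comp[OF assms smooth_on_ident]
      smooth_on_const])

lemma iterated_deriv_cong:
  assumes "open S" "\<And>y. y \<in> S \<Longrightarrow> f y = g y" "x \<in> S"
  shows "iterated_deriv vs f x = iterated_deriv vs g x"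
  using assms(3)
proof (induction vs arbitrary: x)
  case (Cons v vs)
  have "frechet_derivative (iterated_deriv vs f) (at x) = frechet_derivative (iterated_deriv vs g) (at x)"
    by (rule frechet_derivative_cong_open[OF assms(1) Cons.prems]) (rule Cons.IH)
  then show ?case by simp
qed (simp add: assms(2))

lemma mixed_difference_eq_second_derivative:
  fixes f :: "'a::euclidean_space \<Rightarrow> real"
  assumes "smooth_on (ball x r) f" "s > 0" "s * (norm u + norm v) < r"
  shows "\<exists>y. norm (y - x) \<le> s * (norm u + norm v) \<and>
    f (x + s *\<^sub>R u + s *\<^sub>R v) - f (x + s *\<^sub>R u) - f (x + s *\<^sub>R v) + f x = s * s * partial v (partial u f) y"
proof -
  have bound: "norm (a *\<^sub>R u + b *\<^sub>R v) \<le> s * (norm u + norm v)"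
    if "0 \<le> a" "a \<le> s" "0 \<le> b" "b \<le> s" for a b
  proof -
    have "norm (a *\<^sub>R u + b *\<^sub>R v) \<le> a * norm u + b * norm v"
      using norm_triangle_ineq[of "a *\<^sub>R u" "b *\<^sub>R v"] that by simp
    also have "\<dots> \<le> s * norm u + s * norm v"
      using that by (intro add_mono mult_right_mono) auto
    finally show ?thesis by (simp add: algebra_simps)
  qed
  have inball: "x + a *\<^sub>R u + b *\<^sub>R v \<in> ball x r"
    if "0 \<le> a" "a \<le> s" "0 \<le> b" "b \<le> s" for a b
  proof -
    have "dist (x + a *\<^sub>R u + b *\<^sub>R v) x = norm (a *\<^sub>R u + b *\<^sub>R v)"
      by (simp add: dist_norm)
    then show ?thesis
      using bound[OF that] assms(3) by (simp add: dist_commute)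
  qed
  have der: "((\<lambda>t. h (p + t *\<^sub>R w)) has_real_derivative partial w h (p + t *\<^sub>R w)) (at t)"
    if "h differentiable (at (p + t *\<^sub>R w))" for h :: "'a \<Rightarrow> real" and p w t
  proof -
    have 1: "((\<lambda>t. p + t *\<^sub>R w) has_derivative (\<lambda>d. d *\<^sub>R w)) (at t)"
      by (auto intro!: derivative_eq_intros)
    have 2: "(h has_derivative frechet_derivative h (at (p + t *\<^sub>R w))) (at (p + t *\<^sub>R w))"
      using that frechet_derivative_works by blast
    have "((\<lambda>t. h (p + t *\<^sub>R w)) has_derivative
        (\<lambda>d. frechet_derivative h (at (p + t *\<^sub>R w)) (d *\<^sub>R w))) (at t)"
      using has_derivative_compose[OF 1 2] .
    moreover have "(\<lambda>d. frechet_derivative h (at (p + t *\<^sub>R w)) (d *\<^sub>R w)) =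
        (*) (partial w h (p + t *\<^sub>R w))"
      using linear_frechet_derivative[OF that] by (auto simp: linear_scale)
    ultimately show ?thesis by (simp add: has_field_derivative_def)
  qed
  define g where "g = (\<lambda>a. f ((x + s *\<^sub>R v) + a *\<^sub>R u) - f (x + a *\<^sub>R u))"
  have "\<exists>a. 0 < a \<and> a < s \<and> g s - g 0 =
      (s - 0) * (partial u f ((x + s *\<^sub>R v) + a *\<^sub>R u) - partial u f (x + a *\<^sub>R u))"
  proof (rule MVT2)
    fix a assume a: "0 \<le> a" "a \<le> s"
    have "(x + s *\<^sub>R v) + a *\<^sub>R u \<in> ball x r" "x + a *\<^sub>R u \<in> ball x r"
      using inball[OF a, of s] inball[OF a, of 0] assms(2) by (auto simp: algebra_simps)
    then show "(g has_real_derivative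
        partial u f ((x + s *\<^sub>R v) + a *\<^sub>R u) - partial u f (x + a *\<^sub>R u)) (at a)"
      unfolding g_def using smooth_on_differentiable[OF assms(1)]
      by (intro DERIV_diff der) auto
  qed (use assms in auto)
  then obtain a where a: "0 < a" "a < s" and
    g: "g s - g 0 = s * (partial u f ((x + a *\<^sub>R u) + s *\<^sub>R v) - partial u f (x + a *\<^sub>R u))"
    by (auto simp: algebra_simps)
  have "\<exists>b. 0 < b \<and> b < s \<and>
      partial u f ((x + a *\<^sub>R u) + s *\<^sub>R v) - partial u f ((x + a *\<^sub>R u) + 0 *\<^sub>R v) =
      (s - 0) * partial v (partial u f) ((x + a *\<^sub>R u) + b *\<^sub>R v)"
  proof (rule MVT2)
    fix b assume b: "0 \<le> b" "b \<le> s"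
    have "(x + a *\<^sub>R u) + b *\<^sub>R v \<in> ball x r"
      using inball[OF _ _ b, of a] a by auto
    then show "((\<lambda>b. partial u f ((x + a *\<^sub>R u) + b *\<^sub>R v)) has_real_derivative
        partial v (partial u f) ((x + a *\<^sub>R u) + b *\<^sub>R v)) (at b)"
      using smooth_on_differentiable[OF smooth_on_partial[OF assms(1)]] by (intro der) auto
  qed (use assms in auto)
  then obtain b where b: "0 < b" "b < s" and
    h: "partial u f ((x + a *\<^sub>R u) + s *\<^sub>R v) - partial u f (x + a *\<^sub>R u) =
      s * partial v (partial u f) ((x + a *\<^sub>R u) + b *\<^sub>R v)"
    by auto
  show ?thesis
  proof (intro exI conjI)
    show "norm ((x + a *\<^sub>R u) + b *\<^sub>R v - x) \<le> s * (norm u + norm v)"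
      using bound[of a b] a b by (simp add: algebra_simps)
    show "f (x + s *\<^sub>R u + s *\<^sub>R v) - f (x + s *\<^sub>R u) - f (x + s *\<^sub>R v) + f x =
        s * s * partial v (partial u f) ((x + a *\<^sub>R u) + b *\<^sub>R v)"
      using g unfolding h by (simp add: g_def algebra_simps)
  qed
qed

lemma partial_commute_real:
  fixes f :: "'a::euclidean_space \<Rightarrow> real"
  assumes "open S" "smooth_on S f" "x \<in> S"
  shows "partial u (partial v f) x = partial v (partial u f) x"
proof -
  obtain r where r: "r > 0" "ball x r \<subseteq> S"
    using assms openE by blast
  then have sm: "smooth_on (ball x r) f"
    using assms(2) smooth_on_subset by blast
  define M where "M = norm u + norm v + 1"
  define s where "s n = r / M * inverse (real (Suc n))" for n
  have M: "M > 0" "norm u + norm v < M" "norm v + norm u < M"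
    unfolding M_def using norm_ge_zero[of u] norm_ge_zero[of v] by linarith+
  have s: "s n > 0" "s n * (norm u + norm v) < r" "s n * (norm v + norm u) < r" for n
  proof -
    show pos: "s n > 0" using r M by (simp add: s_def)
    have "inverse (real (Suc n)) \<le> 1"
      by (simp add: inverse_le_1_iff)
    then have "r * inverse (real (Suc n)) \<le> r"
      using mult_left_mono[of "inverse (real (Suc n))" 1 r] r by simp
    moreover have "s n * M = r * inverse (real (Suc n))"
      using M by (simp add: s_def)
    ultimately have "s n * M \<le> r"
      by simp
    then show "s n * (norm u + norm v) < r" "s n * (norm v + norm u) < r"
      using mult_strict_left_mono[OF M(2) pos] mult_strict_left_mono[OF M(3) pos] by linarith+
  qed
  obtain y where y: "\<And>n. norm (y n - x) \<le> s n * (norm u + norm v)"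
    "\<And>n. f (x + s n *\<^sub>R u + s n *\<^sub>R v) - f (x + s n *\<^sub>R u) - f (x + s n *\<^sub>R v) + f x =
      s n * s n * partial v (partial u f) (y n)"
    using mixed_difference_eq_second_derivative[OF sm s(1,2)] by metis
  obtain z where z: "\<And>n. norm (z n - x) \<le> s n * (norm v + norm u)"
    "\<And>n. f (x + s n *\<^sub>R v + s n *\<^sub>R u) - f (x + s n *\<^sub>R v) - f (x + s n *\<^sub>R u) + f x =
      s n * s n * partial u (partial v f) (z n)"
    using mixed_difference_eq_second_derivative[OF sm s(1,3)] by metis
  have eq: "partial v (partial u f) (y n) = partial u (partial v f) (z n)" for n
  proof -
    have "s n * s n * partial v (partial u f) (y n) = s n * s n * partial u (partial v f) (z n)"
      using y(2)[of n] z(2)[of n] by (simp add: algebra_simps)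
    then show ?thesis using s(1)[of n] by simp
  qed
  have lim: "w \<longlonglongrightarrow> x" if "\<And>n. norm (w n - x) \<le> s n * C" for w :: "nat \<Rightarrow> 'a" and C
  proof -
    have "(\<lambda>n. s n * C) \<longlonglongrightarrow> 0"
      unfolding s_def
      by (rule tendsto_mult_left_zero[OF tendsto_mult_right_zero[OF LIMSEQ_inverse_real_of_nat]])
    then show ?thesis
      using that by (intro LIM_zero_cancel[of w] Lim_null_comparison[of "\<lambda>n. w n - x" "\<lambda>n. s n * C"]) simp_all
  qed
  have "isCont (partial a (partial b f)) x" for a b
    using smooth_on_continuous[OF smooth_on_partial[OF smooth_on_partial[OF assms(2)]]] assms
    by (simp add: continuous_on_eq_continuous_at)
  then have "(\<lambda>n. partial v (partial u f) (y n)) \<longlonglongrightarrow> partial v (partial u f) x"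
    "(\<lambda>n. partial u (partial v f) (z n)) \<longlonglongrightarrow> partial u (partial v f) x"
    by (rule isCont_tendsto_compose[OF _ lim[OF y(1)]], rule isCont_tendsto_compose[OF _ lim[OF z(1)]])
  then show ?thesis
    using eq LIMSEQ_unique by simp
qed

lemma partial_commute:
  fixes f :: "'a::euclidean_space \<Rightarrow> 'b::euclidean_space"
  assumes "open S" "smooth_on S f" "x \<in> S"
  shows "partial u (partial v f) x = partial v (partial u f) x"
proof (rule euclidean_eqI)
  fix i :: 'b
  have inner: "partial a (\<lambda>y. h y \<bullet> i) y = partial a h y \<bullet> i" if "smooth_on S h" "y \<in> S" for a h y
    using frechet_derivative_bounded_linear_comp[OF bounded_linear_inner_left
        smooth_on_differentiable[OF that]] by metis
  have two: "partial a (partial b (\<lambda>y. f y \<bullet> i)) x = partial a (partial b f) x \<bullet> i" for a b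
    using frechet_derivative_cong_open[OF assms(1,3), of "partial b (\<lambda>y. f y \<bullet> i)" "\<lambda>y. partial b f y \<bullet> i"]
      inner[OF assms(2)] inner[OF smooth_on_partial[OF assms(2)] assms(3)] by simp
  show "partial u (partial v f) x \<bullet> i = partial v (partial u f) x \<bullet> i"
    using partial_commute_real[OF assms(1) smooth_on_bounded_linear_comp[OF assms(1)
        bounded_linear_inner_left[of i] assms(2)] assms(3), where u = u and v = v] by (simp only: two)
qed

section \<open>Taylor expansion in powers of given functions\<close>

lemma iterated_deriv_snoc: "iterated_deriv (vs @ [v]) f = iterated_deriv vs (partial v f)"
  by (induction vs) auto

definition flat_at :: "nat \<Rightarrow> 'a::euclidean_space \<Rightarrow> ('a \<Rightarrow> complex) \<Rightarrow> bool" where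
  "flat_at k p f \<longleftrightarrow> (\<forall>vs. set vs \<subseteq> Basis \<and> length vs < k \<longrightarrow> iterated_deriv vs f p = 0)"

lemma flat_at_0: "flat_at 0 p f"
  by (simp add: flat_at_def)

lemma flat_at_mono: "flat_at k p f \<Longrightarrow> l \<le> k \<Longrightarrow> flat_at l p f"
  by (simp add: flat_at_def)

lemma flat_at_Suc: "flat_at (Suc k) p f \<longleftrightarrow> f p = 0 \<and> (\<forall>b\<in>Basis. flat_at k p (partial b f))"
proof (intro iffI conjI ballI)
  assume f: "flat_at (Suc k) p f"
  then show "f p = 0"
    unfolding flat_at_def by (metis bot.extremum iterated_deriv.simps(1) list.set(1) list.size(3) zero_less_Suc)
  fix b :: 'a assume b: "b \<in> Basis"
  have "iterated_deriv vs (partial b f) p = 0" if "set vs \<subseteq> Basis" "length vs < k" for vs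
    using f that b unfolding flat_at_def by (auto dest!: spec[of _ "vs @ [b]"] simp: iterated_deriv_snoc)
  then show "flat_at k p (partial b f)"
    by (simp add: flat_at_def)
next
  assume f: "f p = 0 \<and> (\<forall>b\<in>Basis. flat_at k p (partial b f))"
  have "iterated_deriv vs f p = 0" if "set vs \<subseteq> Basis" "length vs < Suc k" for vs
    using that f by (cases vs rule: rev_cases) (auto simp: iterated_deriv_snoc flat_at_def)
  then show "flat_at (Suc k) p f"
    by (simp add: flat_at_def)
qed

lemma flat_at_cong:
  assumes "open S" "p \<in> S" "\<And>x. x \<in> S \<Longrightarrow> f x = g x" "flat_at k p f"
  shows "flat_at k p g"
  using assms(4) iterated_deriv_cong[OF assms(1,3,2)] by (simp add: flat_at_def)

lemma flat_at_add:
  assumes "open S" "p \<in> S" "smooth_on S f" "smooth_on S g" "flat_at k p f" "flat_at k p g"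
  shows "flat_at k p (\<lambda>x. f x + g x)"
  using assms(3-)
proof (induction k arbitrary: f g)
  case (Suc k)
  have "flat_at k p (partial b (\<lambda>x. f x + g x))" if "b \<in> Basis" for b
  proof (rule flat_at_cong[OF assms(1,2)])
    show "flat_at k p (\<lambda>x. partial b f x + partial b g x)"
      using Suc.prems that by (intro Suc.IH smooth_on_partial) (auto simp: flat_at_Suc)
    show "partial b f x + partial b g x = partial b (\<lambda>x. f x + g x) x" if "x \<in> S" for x
      by (simp add: frechet_derivative_add[OF smooth_on_differentiable[OF Suc.prems(1) that]
            smooth_on_differentiable[OF Suc.prems(2) that]])
  qed
  then show ?case using Suc.prems by (simp add: flat_at_Suc)
qed (simp add: flat_at_0)

lemma flat_at_mult:
  assumes "open S" "p \<in> S" "smooth_on S f" "smooth_on S g" "flat_at k p f" "flat_at l p g"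
  shows "flat_at (k + l) p (\<lambda>x. f x * g x)"
proof -
  have "flat_at m p (\<lambda>x. f x * g x)" if "m \<le> k + l" for m
    using assms(3-) that
  proof (induction m arbitrary: f g k l)
    case (Suc m)
    have zero: "f p * g p = 0"
      using Suc.prems by (cases k; cases l) (auto simp: flat_at_Suc)
    have "flat_at m p (partial b (\<lambda>x. f x * g x))" if b: "b \<in> Basis" for b
    proof (rule flat_at_cong[OF assms(1,2)])
      have flat: "flat_at (j - 1) p (partial b h)" if "flat_at j p h" for j h
        using that b by (cases j) (auto simp: flat_at_Suc flat_at_0)
      have "flat_at m p (\<lambda>x. f x * partial b g x)"
        using Suc.prems by (intro Suc.IH[of _ _ k "l - 1"] smooth_on_partial flat) auto
      moreover have "flat_at m p (\<lambda>x. partial b f x * g x)"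
        using Suc.prems by (intro Suc.IH[of _ _ "k - 1" l] smooth_on_partial flat) auto
      ultimately show "flat_at m p (\<lambda>x. f x * partial b g x + partial b f x * g x)"
        using Suc.prems
        by (intro flat_at_add[OF assms(1,2)] smooth_on_mult[OF assms(1)] smooth_on_partial) auto
      show "f x * partial b g x + partial b f x * g x = partial b (\<lambda>x. f x * g x) x"
        if "x \<in> S" for x
        using frechet_derivative_bilinear[OF bounded_bilinear_mult
            smooth_on_differentiable[OF Suc.prems(1) that]
            smooth_on_differentiable[OF Suc.prems(2) that]] by simp
    qed
    then show ?case using zero by (simp add: flat_at_Suc)
  qed (simp add: flat_at_0)
  then show ?thesis by simp
qed

lemma flat_at_cmult:
  assumes "open S" "p \<in> S" "smooth_on S f" "flat_at k p f"
  shows "flat_at k p (\<lambda>x. c * f x)"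
  using flat_at_mult[OF assms(1,2) smooth_on_const assms(3) flat_at_0 assms(4)] by simp

lemma flat_at_diff:
  assumes "open S" "p \<in> S" "smooth_on S f" "smooth_on S g" "flat_at k p f" "flat_at k p g"
  shows "flat_at k p (\<lambda>x. f x - g x)"
  using flat_at_add[OF assms(1-3) smooth_on_mult[OF assms(1) smooth_on_const assms(4)] assms(5)
      flat_at_cmult[OF assms(1,2,4,6)], of "- 1"] by simp

lemma flat_at_sum:
  assumes "open S" "p \<in> S" "\<And>i. i \<in> I \<Longrightarrow> smooth_on S (f i)" "\<And>i. i \<in> I \<Longrightarrow> flat_at k p (f i)"
  shows "flat_at k p (\<lambda>x. \<Sum>i\<in>I. f i x)"
proof -
  have zero: "flat_at k p (\<lambda>x. 0)"
    by (induction k) (simp_all add: flat_at_0 flat_at_Suc)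
  show ?thesis
    using assms(3,4)
    by (induction I rule: infinite_finite_induct)
      (simp_all add: zero flat_at_add[OF assms(1,2)] smooth_on_sum[OF assms(1)])
qed

lemma flat_at_coordinate: "flat_at (Suc 0) p (\<lambda>x. of_real ((x - p) \<bullet> b))"
  by (simp add: flat_at_Suc flat_at_0)

lemma bounded_linear_coordinate: "bounded_linear (\<lambda>x. complex_of_real (x \<bullet> b))"
  by (intro bounded_linear_compose[OF bounded_linear_of_real] bounded_linear_inner_left)

lemma smooth_on_coordinate: "open S \<Longrightarrow> smooth_on S (\<lambda>x. complex_of_real ((x - p) \<bullet> b))"
  using smooth_on_affine[OF _ bounded_linear_coordinate, of S b "- complex_of_real (p \<bullet> b)"]
  by (simp add: inner_diff_left)

text \<open>A Taylor expansion to one order in the form of Euler's identity for homogeneous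
  functions, so that no factorials or symmetrised products occur.\<close>

lemma flat_at_euler:
  fixes f :: "'a::euclidean_space \<Rightarrow> complex"
  assumes "open S" "p \<in> S" "smooth_on S f" "flat_at k p f"
  shows "flat_at (Suc k) p
    (\<lambda>x. of_nat k * f x - (\<Sum>b\<in>Basis. of_real ((x - p) \<bullet> b) * partial b f x))"
  using assms(3,4)
proof (induction k arbitrary: f)
  case 0
  then show ?case by (simp add: flat_at_Suc flat_at_0)
next
  case (Suc k)
  let ?g = "\<lambda>c f x. of_nat c * f x - (\<Sum>b\<in>Basis. of_real ((x - p) \<bullet> b) * partial b f x)"
  have "flat_at (Suc k) p (partial u (?g (Suc k) f))" if u: "u \<in> Basis" for u
  proof (rule flat_at_cong[OF assms(1,2)])
    show "flat_at (Suc k) p (?g k (partial u f))"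
      using Suc.prems u by (intro Suc.IH smooth_on_partial) (auto simp: flat_at_Suc[of "k"])
    fix x assume x: "x \<in> S"
    have f: "(f has_derivative frechet_derivative f (at x)) (at x)"
      using smooth_on_differentiable[OF Suc.prems(1) x] by (simp add: frechet_derivative_works)
    have df: "(partial b f has_derivative frechet_derivative (partial b f) (at x)) (at x)" for b
      using smooth_on_differentiable[OF smooth_on_partial[OF Suc.prems(1)] x]
      by (simp add: frechet_derivative_works)
    have "(?g (Suc k) f has_derivative (\<lambda>v. of_nat (Suc k) * partial v f x -
        (\<Sum>b\<in>Basis. of_real ((x - p) \<bullet> b) * partial v (partial b f) x +
          of_real (v \<bullet> b) * partial b f x))) (at x)"
      by (auto intro!: derivative_eq_intros f df)
    then have "partial u (?g (Suc k) f) x = of_nat (Suc k) * partial u f x -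
        (\<Sum>b\<in>Basis. of_real ((x - p) \<bullet> b) * partial u (partial b f) x +
          of_real (u \<bullet> b) * partial b f x)"
      by (simp add: frechet_derivative_at[symmetric])
    moreover have "(\<Sum>b\<in>Basis. of_real (u \<bullet> b) * partial b f x) = partial u f x"
    proof -
      have "(\<Sum>b\<in>Basis. of_real (u \<bullet> b) * partial b f x) =
          (\<Sum>b\<in>Basis. if b = u then partial b f x else 0)"
        using u by (intro sum.cong) (auto simp: inner_Basis)
      then show ?thesis using u by simp
    qed
    moreover have "partial u (partial b f) x = partial b (partial u f) x" for b
      by (rule partial_commute[OF assms(1) Suc.prems(1) x])
    ultimately have "partial u (?g (Suc k) f) x = of_nat (Suc k) * partial u f x -
        ((\<Sum>b\<in>Basis. of_real ((x - p) \<bullet> b) * partial b (partial u f) x) + partial u f x)"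
      by (simp only: sum.distrib)
    moreover have "of_nat (Suc k) * d - (t + d) = of_nat k * d - t" for d t :: complex
      by (simp add: algebra_simps)
    ultimately show "?g k (partial u f) x = partial u (?g (Suc k) f) x"
      by simp
  qed
  then show ?case using Suc.prems by (simp add: flat_at_Suc[of "Suc k"] flat_at_Suc[of k _ f])
qed

lemma finite_multi_indices: "finite (multi_indices n l N)"
proof (rule finite_subset)
  show "finite {\<alpha>. \<forall>i. (i \<in> {..<n} \<longrightarrow> \<alpha> i \<in> {..N}) \<and> (i \<notin> {..<n} \<longrightarrow> \<alpha> i = 0)}"
    by (intro finite_set_of_finite_funs) auto
  show "multi_indices n l N \<subseteq>
      {\<alpha>. \<forall>i. (i \<in> {..<n} \<longrightarrow> \<alpha> i \<in> {..N}) \<and> (i \<notin> {..<n} \<longrightarrow> \<alpha> i = 0)}"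
  proof
    fix \<alpha> assume \<alpha>: "\<alpha> \<in> multi_indices n l N"
    have "\<alpha> i \<le> N" if "i < n" for i
      using member_le_sum[of i "{..<n}" \<alpha>] that \<alpha> by (simp add: multi_indices_def)
    then show "\<alpha> \<in> {\<alpha>. \<forall>i. (i \<in> {..<n} \<longrightarrow> \<alpha> i \<in> {..N}) \<and> (i \<notin> {..<n} \<longrightarrow> \<alpha> i = 0)}"
      using \<alpha> by (auto simp: multi_indices_def)
  qed
qed

definition monomial :: "nat \<Rightarrow> (nat \<Rightarrow> 'a \<Rightarrow> complex) \<Rightarrow> (nat \<Rightarrow> nat) \<Rightarrow> 'a \<Rightarrow> complex" where
  "monomial n r \<alpha> x = (\<Prod>j<n. r j x ^ \<alpha> j)"

definition homogeneous :: "nat \<Rightarrow> (nat \<Rightarrow> 'a \<Rightarrow> complex) \<Rightarrow> nat \<Rightarrow> ('a \<Rightarrow> complex) set" where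
  "homogeneous n r k =
     {\<lambda>x. \<Sum>\<alpha>\<in>multi_indices n k (Suc k). c \<alpha> * monomial n r \<alpha> x | c. True}"

lemma homogeneous_add:
  assumes "f \<in> homogeneous n r k" "g \<in> homogeneous n r k"
  shows "(\<lambda>x. f x + g x) \<in> homogeneous n r k"
proof -
  obtain c d where "f = (\<lambda>x. \<Sum>\<alpha>\<in>multi_indices n k (Suc k). c \<alpha> * monomial n r \<alpha> x)"
    "g = (\<lambda>x. \<Sum>\<alpha>\<in>multi_indices n k (Suc k). d \<alpha> * monomial n r \<alpha> x)"
    using assms unfolding homogeneous_def by auto
  then show ?thesis
    unfolding homogeneous_def
    by (intro CollectI exI[of _ "\<lambda>\<alpha>. c \<alpha> + d \<alpha>"]) (auto simp: sum.distrib algebra_simps)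
qed

lemma homogeneous_cmult:
  assumes "f \<in> homogeneous n r k"
  shows "(\<lambda>x. a * f x) \<in> homogeneous n r k"
proof -
  obtain c where "f = (\<lambda>x. \<Sum>\<alpha>\<in>multi_indices n k (Suc k). c \<alpha> * monomial n r \<alpha> x)"
    using assms unfolding homogeneous_def by auto
  then show ?thesis
    unfolding homogeneous_def
    by (intro CollectI exI[of _ "\<lambda>\<alpha>. a * c \<alpha>"]) (auto simp: sum_distrib_left algebra_simps)
qed

lemma homogeneous_sum:
  assumes "\<And>i. i \<in> I \<Longrightarrow> f i \<in> homogeneous n r k"
  shows "(\<lambda>x. \<Sum>i\<in>I. f i x) \<in> homogeneous n r k"
proof -
  have zero: "(\<lambda>x. 0) \<in> homogeneous n r k"
    unfolding homogeneous_def by (intro CollectI exI[of _ "\<lambda>\<alpha>. 0"]) auto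
  show ?thesis
    using assms by (induction I rule: infinite_finite_induct) (simp_all add: zero homogeneous_add)
qed

lemma monomial_homogeneous:
  assumes "\<alpha> \<in> multi_indices n k (Suc k)"
  shows "monomial n r \<alpha> \<in> homogeneous n r k"
proof -
  have "monomial n r \<alpha> x =
      (\<Sum>\<beta>\<in>multi_indices n k (Suc k). (if \<beta> = \<alpha> then 1 else 0) * monomial n r \<beta> x)" for x
    using assms by (simp add: finite_multi_indices if_distrib[of "\<lambda>c. c * _"] cong: if_cong)
  then show ?thesis
    unfolding homogeneous_def
    by (intro CollectI exI[of _ "\<lambda>\<beta>. if \<beta> = \<alpha> then 1 else 0"]) auto
qed

lemma homogeneous_mult_generator:
  assumes "f \<in> homogeneous n r k" "j < n"
  shows "(\<lambda>x. r j x * f x) \<in> homogeneous n r (Suc k)"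
proof -
  obtain c where c: "f = (\<lambda>x. \<Sum>\<alpha>\<in>multi_indices n k (Suc k). c \<alpha> * monomial n r \<alpha> x)"
    using assms unfolding homogeneous_def by auto
  have mono: "r j x * monomial n r \<alpha> x = monomial n r (\<alpha>(j := Suc (\<alpha> j))) x" for \<alpha> x
  proof -
    have "monomial n r (\<alpha>(j := Suc (\<alpha> j))) x =
        r j x * r j x ^ \<alpha> j * (\<Prod>i\<in>{..<n} - {j}. r i x ^ (\<alpha>(j := Suc (\<alpha> j))) i)"
      unfolding monomial_def using assms(2) by (subst prod.remove[of _ j]) auto
    also have "(\<Prod>i\<in>{..<n} - {j}. r i x ^ (\<alpha>(j := Suc (\<alpha> j))) i) = (\<Prod>i\<in>{..<n} - {j}. r i x ^ \<alpha> i)"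
      by (intro prod.cong) auto
    also have "r j x * r j x ^ \<alpha> j * \<dots> = r j x * monomial n r \<alpha> x"
      unfolding monomial_def using assms(2) by (subst (2) prod.remove[of _ j]) auto
    finally show ?thesis by (rule sym)
  qed
  have "\<alpha>(j := Suc (\<alpha> j)) \<in> multi_indices n (Suc k) (Suc (Suc k))"
    if "\<alpha> \<in> multi_indices n k (Suc k)" for \<alpha>
  proof -
    have "(\<Sum>i<n. (\<alpha>(j := Suc (\<alpha> j))) i) = Suc (\<alpha> j) + (\<Sum>i\<in>{..<n} - {j}. (\<alpha>(j := Suc (\<alpha> j))) i)"
      using assms(2) by (subst sum.remove[of _ j]) auto
    also have "(\<Sum>i\<in>{..<n} - {j}. (\<alpha>(j := Suc (\<alpha> j))) i) = (\<Sum>i\<in>{..<n} - {j}. \<alpha> i)"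
      by (intro sum.cong) auto
    also have "Suc (\<alpha> j) + \<dots> = Suc (\<Sum>i<n. \<alpha> i)"
      using assms(2) by (subst (2) sum.remove[of _ j]) auto
    finally show ?thesis using that assms(2) by (auto simp: multi_indices_def)
  qed
  then have "(\<lambda>x. \<Sum>\<alpha>\<in>multi_indices n k (Suc k). c \<alpha> * monomial n r (\<alpha>(j := Suc (\<alpha> j))) x)
      \<in> homogeneous n r (Suc k)"
    by (rule homogeneous_sum[OF homogeneous_cmult[OF monomial_homogeneous]])
  moreover have "r j x * f x =
      (\<Sum>\<alpha>\<in>multi_indices n k (Suc k). c \<alpha> * monomial n r (\<alpha>(j := Suc (\<alpha> j))) x)" for x
    unfolding c mono[symmetric] by (simp add: sum_distrib_left mult.left_commute)
  ultimately show ?thesis by simp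
qed

lemma smooth_on_monomial:
  assumes "open S" "\<And>j. j < n \<Longrightarrow> smooth_on S (r j)"
  shows "smooth_on S (monomial n r \<alpha>)"
proof -
  have "smooth_on S (\<lambda>x. \<Prod>j<n. r j x ^ \<alpha> j)"
    by (rule smooth_on_prod[OF assms(1) smooth_on_power[OF assms(1)]]) (simp add: assms(2))
  then show ?thesis
    by (simp add: monomial_def[abs_def])
qed

lemma smooth_on_homogeneous:
  assumes "open S" "\<And>j. j < n \<Longrightarrow> smooth_on S (r j)" "f \<in> homogeneous n r k"
  shows "smooth_on S f"
proof -
  obtain c where c: "f = (\<lambda>x. \<Sum>\<alpha>\<in>multi_indices n k (Suc k). c \<alpha> * monomial n r \<alpha> x)"
    using assms unfolding homogeneous_def by auto
  show ?thesis
    unfolding c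
    by (rule smooth_on_sum[OF assms(1) smooth_on_mult[OF assms(1) smooth_on_const
          smooth_on_monomial[OF assms(1,2)]]])
qed

lemma flat_at_expansion_homogeneous:
  fixes f :: "'a::euclidean_space \<Rightarrow> complex"
  assumes S: "open S" "p \<in> S"
    and r: "\<And>j. j < n \<Longrightarrow> smooth_on S (r j)"
    and r_flat: "\<And>j. j < n \<Longrightarrow> flat_at 1 p (r j)"
    and coord: "\<And>b. b \<in> Basis \<Longrightarrow>
      flat_at 2 p (\<lambda>x. of_real ((x - p) \<bullet> b) - (\<Sum>j<n. \<beta> b j * r j x))"
    and f: "smooth_on S f" "flat_at k p f"
  shows "\<exists>h\<in>homogeneous n r k. flat_at (Suc k) p (\<lambda>x. f x - h x)"
  using f
proof (induction k arbitrary: f)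
  case 0
  have zero: "(\<lambda>_. 0) \<in> multi_indices n 0 (Suc 0)"
    by (simp add: multi_indices_def)
  have "(\<lambda>x. f p * monomial n r (\<lambda>_. 0) x) \<in> homogeneous n r 0"
    by (rule homogeneous_cmult[OF monomial_homogeneous[OF zero]])
  moreover have "flat_at (Suc 0) p (\<lambda>x. f x - f p * monomial n r (\<lambda>_. 0) x)"
    by (simp add: flat_at_Suc flat_at_0 monomial_def)
  ultimately show ?case
    by (intro bexI[of _ "\<lambda>x. f p * monomial n r (\<lambda>_. 0) x"])
next
  case (Suc k)
  note sm = smooth_on_partial[OF Suc.prems(1)]
  have "\<exists>h\<in>homogeneous n r k. flat_at (Suc k) p (\<lambda>x. partial b f x - h x)" if "b \<in> Basis" for b
    using Suc.prems that by (intro Suc.IH sm) (auto simp: flat_at_Suc[of k])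
  then obtain h where h: "\<And>b. b \<in> Basis \<Longrightarrow> h b \<in> homogeneous n r k"
    "\<And>b. b \<in> Basis \<Longrightarrow> flat_at (Suc k) p (\<lambda>x. partial b f x - h b x)"
    by metis
  have smh: "smooth_on S (h b)" if "b \<in> Basis" for b
    by (rule smooth_on_homogeneous[OF S(1) r h(1)[OF that]])
  have smd: "smooth_on S (\<lambda>x. partial b f x - h b x)" if "b \<in> Basis" for b
    by (rule smooth_on_diff[OF S(1) sm smh[OF that]])
  have smr: "smooth_on S (\<lambda>x. of_real ((x - p) \<bullet> b) - (\<Sum>j<n. \<beta> b j * r j x))" for b
    by (intro smooth_on_diff[OF S(1)] smooth_on_coordinate[OF S(1)] smooth_on_sum[OF S(1)]
        smooth_on_mult[OF S(1) smooth_on_const] r) simp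
  have flat_h: "flat_at k p (h b)" if "b \<in> Basis" for b
  proof -
    have "flat_at k p (\<lambda>x. partial b f x - (partial b f x - h b x))"
      using Suc.prems that
      by (intro flat_at_diff[OF S sm smd] flat_at_mono[OF h(2)]) (auto simp: flat_at_Suc[of k])
    then show ?thesis by simp
  qed
  define H where "H x = (1 / of_nat (Suc k)) * (\<Sum>b\<in>Basis. \<Sum>j<n. \<beta> b j * (r j x * h b x))" for x
  define E1 where "E1 x = of_nat (Suc k) * f x - (\<Sum>b\<in>Basis. of_real ((x - p) \<bullet> b) * partial b f x)" for x
  define E2 where "E2 x = (\<Sum>b\<in>Basis. of_real ((x - p) \<bullet> b) * (partial b f x - h b x))" for x
  define E3 where "E3 x = (\<Sum>b\<in>Basis. (of_real ((x - p) \<bullet> b) - (\<Sum>j<n. \<beta> b j * r j x)) * h b x)" for x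
  have H: "H \<in> homogeneous n r (Suc k)"
    unfolding H_def
    by (intro homogeneous_cmult homogeneous_sum homogeneous_mult_generator h) simp_all
  have E1: "flat_at (Suc (Suc k)) p E1"
    unfolding E1_def by (rule flat_at_euler[OF S Suc.prems])
  have E2: "flat_at (Suc (Suc k)) p E2"
    unfolding E2_def
  proof (rule flat_at_sum[OF S])
    fix b :: 'a assume b: "b \<in> Basis"
    show "smooth_on S (\<lambda>x. of_real ((x - p) \<bullet> b) * (partial b f x - h b x))"
      by (rule smooth_on_mult[OF S(1) smooth_on_coordinate[OF S(1)] smd[OF b]])
    show "flat_at (Suc (Suc k)) p (\<lambda>x. of_real ((x - p) \<bullet> b) * (partial b f x - h b x))"
      using flat_at_mult[OF S smooth_on_coordinate[OF S(1)] smd[OF b] flat_at_coordinate h(2)[OF b]]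
      by simp
  qed
  have E3: "flat_at (Suc (Suc k)) p E3"
    unfolding E3_def
  proof (rule flat_at_sum[OF S])
    fix b :: 'a assume b: "b \<in> Basis"
    show "smooth_on S (\<lambda>x. (of_real ((x - p) \<bullet> b) - (\<Sum>j<n. \<beta> b j * r j x)) * h b x)"
      by (rule smooth_on_mult[OF S(1) smr smh[OF b]])
    show "flat_at (Suc (Suc k)) p (\<lambda>x. (of_real ((x - p) \<bullet> b) - (\<Sum>j<n. \<beta> b j * r j x)) * h b x)"
      using flat_at_mult[OF S smr smh[OF b] coord[OF b] flat_h[OF b]] by simp
  qed
  have sm1: "smooth_on S E1"
    unfolding E1_def
    by (intro smooth_on_diff[OF S(1)] smooth_on_mult[OF S(1)] smooth_on_const Suc.prems(1)
        smooth_on_sum[OF S(1)] smooth_on_coordinate[OF S(1)] sm)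
  have sm2: "smooth_on S E2"
    unfolding E2_def
    by (rule smooth_on_sum[OF S(1) smooth_on_mult[OF S(1) smooth_on_coordinate[OF S(1)] smd]])
  have sm3: "smooth_on S E3"
    unfolding E3_def by (rule smooth_on_sum[OF S(1) smooth_on_mult[OF S(1) smr smh]])
  have "f x - H x = (1 / of_nat (Suc k)) * (E1 x + (E2 x + E3 x))" for x
  proof -
    have "E1 x + (E2 x + E3 x) = of_nat (Suc k) * f x - (\<Sum>b\<in>Basis. \<Sum>j<n. \<beta> b j * (r j x * h b x))"
      unfolding E1_def E2_def E3_def
      by (simp add: left_diff_distrib right_diff_distrib sum_subtractf sum_distrib_right mult.assoc)
    then show ?thesis
      unfolding H_def by (simp add: right_diff_distrib del: of_nat_Suc)
  qed
  then have "flat_at (Suc (Suc k)) p (\<lambda>x. f x - H x)"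
    using flat_at_cmult[OF S smooth_on_add[OF S(1) sm1 smooth_on_add[OF S(1) sm2 sm3]]
        flat_at_add[OF S sm1 smooth_on_add[OF S(1) sm2 sm3] E1 flat_at_add[OF S sm2 sm3 E2 E3]],
        of "1 / of_nat (Suc k)"]
    by simp
  then show ?case using H by blast
qed

lemma flat_at_expansion:
  fixes f :: "'a::euclidean_space \<Rightarrow> complex"
  assumes S: "open S" "p \<in> S"
    and r: "\<And>j. j < n \<Longrightarrow> smooth_on S (r j)"
    and r_flat: "\<And>j. j < n \<Longrightarrow> flat_at 1 p (r j)"
    and coord: "\<And>b. b \<in> Basis \<Longrightarrow>
      flat_at 2 p (\<lambda>x. of_real ((x - p) \<bullet> b) - (\<Sum>j<n. \<beta> b j * r j x))"
    and f: "smooth_on S f" "flat_at l p f"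
  shows "\<exists>c. flat_at N p (\<lambda>x. f x - (\<Sum>\<alpha>\<in>multi_indices n l N. c \<alpha> * monomial n r \<alpha> x))"
proof (cases "N \<le> l")
  case True
  then have "multi_indices n l N = {}"
    by (auto simp: multi_indices_def)
  then show ?thesis
    using flat_at_mono[OF f(2) True] by simp
next
  case False
  then have "l \<le> N" by simp
  then show ?thesis
  proof (induction N rule: dec_induct)
    case base
    have "multi_indices n l l = {}"
      by (auto simp: multi_indices_def)
    then show ?case using f(2) by simp
  next
    case (step N)
    obtain c where c: "flat_at N p
        (\<lambda>x. f x - (\<Sum>\<alpha>\<in>multi_indices n l N. c \<alpha> * monomial n r \<alpha> x))"
      using step.IH by blast
    have sm: "smooth_on S (\<lambda>x. f x - (\<Sum>\<alpha>\<in>multi_indices n l N. c \<alpha> * monomial n r \<alpha> x))"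
      by (rule smooth_on_diff[OF S(1) f(1) smooth_on_sum[OF S(1) smooth_on_mult[OF S(1)
            smooth_on_const smooth_on_monomial[OF S(1) r]]]])
    obtain d where d: "flat_at (Suc N) p
        (\<lambda>x. f x - (\<Sum>\<alpha>\<in>multi_indices n l N. c \<alpha> * monomial n r \<alpha> x) -
          (\<Sum>\<alpha>\<in>multi_indices n N (Suc N). d \<alpha> * monomial n r \<alpha> x))"
      using flat_at_expansion_homogeneous[OF S r r_flat coord sm c] unfolding homogeneous_def by auto
    let ?e = "\<lambda>\<alpha>. if (\<Sum>j<n. \<alpha> j) < N then c \<alpha> else d \<alpha>"
    have split: "multi_indices n l (Suc N) = multi_indices n l N \<union> multi_indices n N (Suc N)"
      "multi_indices n l N \<inter> multi_indices n N (Suc N) = {}"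
      using step.hyps by (auto simp: multi_indices_def)
    have "(\<Sum>\<alpha>\<in>multi_indices n l (Suc N). ?e \<alpha> * monomial n r \<alpha> x) =
        (\<Sum>\<alpha>\<in>multi_indices n l N. c \<alpha> * monomial n r \<alpha> x) +
        (\<Sum>\<alpha>\<in>multi_indices n N (Suc N). d \<alpha> * monomial n r \<alpha> x)" for x
    proof -
      have "(\<Sum>\<alpha>\<in>multi_indices n l (Suc N). ?e \<alpha> * monomial n r \<alpha> x) =
          (\<Sum>\<alpha>\<in>multi_indices n l N. ?e \<alpha> * monomial n r \<alpha> x) +
          (\<Sum>\<alpha>\<in>multi_indices n N (Suc N). ?e \<alpha> * monomial n r \<alpha> x)"
        unfolding split(1) by (rule sum.union_disjoint[OF finite_multi_indices finite_multi_indices split(2)])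
      also have "(\<Sum>\<alpha>\<in>multi_indices n l N. ?e \<alpha> * monomial n r \<alpha> x) =
          (\<Sum>\<alpha>\<in>multi_indices n l N. c \<alpha> * monomial n r \<alpha> x)"
        by (intro sum.cong) (auto simp: multi_indices_def)
      also have "(\<Sum>\<alpha>\<in>multi_indices n N (Suc N). ?e \<alpha> * monomial n r \<alpha> x) =
          (\<Sum>\<alpha>\<in>multi_indices n N (Suc N). d \<alpha> * monomial n r \<alpha> x)"
        by (intro sum.cong) (auto simp: multi_indices_def)
      finally show ?thesis .
    qed
    then show ?case
      using d by (intro exI[of _ ?e]) (simp add: diff_diff_eq)
  qed
qed

section \<open>Differential operators on Lie groups\<close>

lemma finite_basis_words: "finite (basis_words m :: 'a::euclidean_space list set)"
  unfolding basis_words_def by (rule finite_lists_length_le) simp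

lemma Nil_in_basis_words: "[] \<in> basis_words m"
  by (simp add: basis_words_def)

lemma basis_words_Suc:
  "basis_words (Suc m) = insert [] ((\<lambda>(b, ws). b # ws) ` (Basis \<times> basis_words m))"
proof (intro equalityI subsetI)
  fix ws :: "'a list" assume "ws \<in> basis_words (Suc m)"
  then show "ws \<in> insert [] ((\<lambda>(b, ws). b # ws) ` (Basis \<times> basis_words m))"
    by (cases ws) (auto simp: basis_words_def)
qed (auto simp: basis_words_def)

lemma sum_basis_words_Suc:
  fixes g :: "'a::euclidean_space list \<Rightarrow> complex"
  shows "(\<Sum>ws\<in>basis_words (Suc m). g ws) = g [] + (\<Sum>ws\<in>basis_words m. \<Sum>b\<in>Basis. g (b # ws))"
proof -
  have "(\<Sum>ws\<in>(\<lambda>(b, ws). b # ws) ` (Basis \<times> basis_words m). g ws) =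
      (\<Sum>(b, ws)\<in>Basis \<times> basis_words m. g (b # ws))"
    by (subst sum.reindex) (auto intro!: inj_onI sum.cong)
  also have "\<dots> = (\<Sum>b\<in>Basis. \<Sum>ws\<in>basis_words m. g (b # ws))"
    by (rule sum.cartesian_product[symmetric])
  also have "\<dots> = (\<Sum>ws\<in>basis_words m. \<Sum>b\<in>Basis. g (b # ws))"
    by (rule sum.swap)
  finally show ?thesis
    unfolding basis_words_Suc by (subst sum.insert) (auto simp: finite_basis_words)
qed

text \<open>Leibniz rule and chain rule at once, with the combinatorial coefficients left implicit.\<close>

lemma iterated_deriv_mult_comp:
  fixes \<mu> :: "'a::euclidean_space \<Rightarrow> 'b::euclidean_space"
  assumes T: "open T" and S: "open S" and \<mu>: "smooth_on T \<mu>" "\<mu> ` T \<subseteq> S"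
    and h: "smooth_on T h" and len: "length vs \<le> m"
  shows "\<exists>a. (\<forall>ws. smooth_on T (a ws)) \<and>
    (\<forall>f y. smooth_on S f \<longrightarrow> y \<in> T \<longrightarrow> iterated_deriv vs (\<lambda>x. h x * f (\<mu> x)) y =
      (\<Sum>ws\<in>basis_words m. a ws y * iterated_deriv ws f (\<mu> y)))"
  using len
proof (induction vs arbitrary: m)
  case Nil
  let ?a = "\<lambda>ws. if ws = [] then h else (\<lambda>_. 0)"
  have "(\<Sum>ws\<in>basis_words m. ?a ws y * iterated_deriv ws f (\<mu> y)) = h y * f (\<mu> y)" for f y
  proof -
    have "(\<Sum>ws\<in>basis_words m. ?a ws y * iterated_deriv ws f (\<mu> y)) =
        (\<Sum>(ws::'b list)\<in>basis_words m. if ws = [] then h y * f (\<mu> y) else 0)"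
      by (intro sum.cong) auto
    then show ?thesis
      by (simp add: finite_basis_words Nil_in_basis_words)
  qed
  then show ?case
    by (intro exI[of _ ?a]) (auto simp: h smooth_on_const)
next
  case (Cons v vs)
  obtain k where m: "m = Suc k" and len: "length vs \<le> k"
    using Cons.prems by (cases m) auto
  obtain a where sa: "\<And>ws. smooth_on T (a ws)" and
    a: "\<And>f y. smooth_on S f \<Longrightarrow> y \<in> T \<Longrightarrow> iterated_deriv vs (\<lambda>x. h x * f (\<mu> x)) y =
      (\<Sum>ws\<in>basis_words k. a ws y * iterated_deriv ws f (\<mu> y))"
    using Cons.IH[OF len] by blast
  define d where "d ws = (\<lambda>y. if ws \<in> basis_words k then partial v (a ws) y else 0)" for ws
  define e where "e ws = (case ws of [] \<Rightarrow> (\<lambda>y. 0)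
    | b # us \<Rightarrow> (\<lambda>y. of_real (partial v \<mu> y \<bullet> b) * a us y))" for ws
  have sd: "smooth_on T (d ws)" for ws
    by (cases "ws \<in> basis_words k") (simp_all add: d_def smooth_on_partial sa smooth_on_const)
  have se: "smooth_on T (e ws)" for ws
  proof (cases ws)
    case (Cons b us)
    have "smooth_on T (\<lambda>y. complex_of_real (partial v \<mu> y \<bullet> b))"
      by (rule smooth_on_bounded_linear_comp[OF T bounded_linear_coordinate smooth_on_partial[OF \<mu>(1)]])
    then show ?thesis
      using smooth_on_mult[OF T _ sa] by (simp add: Cons e_def)
  qed (simp add: e_def smooth_on_const)
  show ?case
  proof (intro exI[of _ "\<lambda>ws y. d ws y + e ws y"] conjI allI impI)
    show "smooth_on T (\<lambda>y. d ws y + e ws y)" for ws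
      by (rule smooth_on_add[OF T sd se])
    fix f :: "'b \<Rightarrow> complex" and y assume f: "smooth_on S f" and y: "y \<in> T"
    let ?D = "\<lambda>ws y. iterated_deriv ws f (\<mu> y)"
    have sD: "smooth_on T (?D ws)" for ws
      by (rule smooth_on_comp[OF T S \<mu> smooth_on_iterated_deriv[OF f]])
    have der: "(g has_derivative frechet_derivative g (at y)) (at y)" if "smooth_on T g" for g :: "'a \<Rightarrow> complex"
      using smooth_on_differentiable[OF that y] by (simp add: frechet_derivative_works)
    have part: "partial v (?D ws) y = (\<Sum>b\<in>Basis. of_real (partial v \<mu> y \<bullet> b) * ?D (b # ws) y)" for ws
      using frechet_derivative_comp_Basis[OF smooth_on_differentiable[OF \<mu>(1) y], of "iterated_deriv ws f" v]
        smooth_on_differentiable[OF smooth_on_iterated_deriv[OF f], of "\<mu> y"] \<mu>(2) y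
      by (auto simp: scaleR_conv_of_real)
    have "((\<lambda>y. \<Sum>ws\<in>basis_words k. a ws y * ?D ws y) has_derivative
        (\<lambda>v. \<Sum>ws\<in>basis_words k. a ws y * partial v (?D ws) y + partial v (a ws) y * ?D ws y)) (at y)"
      by (rule has_derivative_sum) (rule has_derivative_mult[OF der[OF sa] der[OF sD]])
    then have "frechet_derivative (\<lambda>y. \<Sum>ws\<in>basis_words k. a ws y * ?D ws y) (at y) v =
        (\<Sum>ws\<in>basis_words k. a ws y * partial v (?D ws) y + partial v (a ws) y * ?D ws y)"
      by (simp add: frechet_derivative_at[symmetric])
    also have "frechet_derivative (\<lambda>y. \<Sum>ws\<in>basis_words k. a ws y * ?D ws y) (at y) =
        frechet_derivative (iterated_deriv vs (\<lambda>x. h x * f (\<mu> x))) (at y)"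
      by (rule frechet_derivative_cong_open[OF T y]) (simp add: a[OF f])
    finally have "iterated_deriv (v # vs) (\<lambda>x. h x * f (\<mu> x)) y =
        (\<Sum>ws\<in>basis_words k. a ws y * partial v (?D ws) y + partial v (a ws) y * ?D ws y)"
      by simp
    also have "\<dots> = (\<Sum>ws\<in>basis_words k. \<Sum>b\<in>Basis. e (b # ws) y * ?D (b # ws) y) +
        (\<Sum>ws\<in>basis_words k. partial v (a ws) y * ?D ws y)"
      by (simp add: part sum.distrib e_def sum_distrib_left mult.left_commute mult.assoc)
    also have "(\<Sum>ws\<in>basis_words k. partial v (a ws) y * ?D ws y) =
        (\<Sum>ws\<in>basis_words (Suc k). d ws y * ?D ws y)"
      by (rule sum.mono_neutral_cong_left[OF finite_basis_words])
        (auto simp: d_def basis_words_def)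
    also have "(\<Sum>ws\<in>basis_words k. \<Sum>b\<in>Basis. e (b # ws) y * ?D (b # ws) y) =
        (\<Sum>ws\<in>basis_words (Suc k). e ws y * ?D ws y)"
      by (simp only: sum_basis_words_Suc) (simp add: e_def)
    finally show "iterated_deriv (v # vs) (\<lambda>x. h x * f (\<mu> x)) y =
        (\<Sum>ws\<in>basis_words m. (d ws y + e ws y) * ?D ws y)"
      by (simp add: m sum.distrib distrib_right add.commute)
  qed
qed

lemma iterated_deriv_slice:
  fixes H :: "'a::euclidean_space \<times> 'b::euclidean_space \<Rightarrow> complex"
  assumes W: "open W" and H: "smooth_on W H" and xy: "(x, y) \<in> W"
  shows "iterated_deriv vs (\<lambda>y. H (x, y)) y = iterated_deriv (map (Pair 0) vs) H (x, y)"
  using xy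
proof (induction vs arbitrary: y)
  case (Cons v vs)
  let ?K = "iterated_deriv (map (Pair 0) vs) H" and ?T = "Pair x -` W"
  have "open ?T"
    by (rule open_vimage[OF W]) (intro continuous_intros)
  then have "frechet_derivative (iterated_deriv vs (\<lambda>y. H (x, y))) (at y) =
      frechet_derivative (\<lambda>y. ?K (x, y)) (at y)"
    by (rule frechet_derivative_cong_open) (use Cons in auto)
  also have "\<dots> = (\<lambda>v. frechet_derivative ?K (at (x, y)) (0, v))"
  proof (rule frechet_derivative_at[symmetric])
    have 1: "(Pair x has_derivative Pair 0) (at y)"
      by (auto intro!: derivative_eq_intros)
    have 2: "(?K has_derivative frechet_derivative ?K (at (x, y))) (at (x, y))"
      using smooth_on_differentiable[OF smooth_on_iterated_deriv[OF H] Cons.prems]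
      by (simp add: frechet_derivative_works)
    show "((\<lambda>y. ?K (x, y)) has_derivative (\<lambda>v. frechet_derivative ?K (at (x, y)) (0, v))) (at y)"
      using has_derivative_compose[OF 1 2] .
  qed
  finally show ?case by simp
qed simp

lemma smooth_atlasD:
  assumes "smooth_atlas A" "(U, \<phi>) \<in> A"
  shows "open U" "open (\<phi> ` U)" "continuous_on (\<phi> ` U) (inv_into U \<phi>)"
    and "x \<in> U \<Longrightarrow> inv_into U \<phi> (\<phi> x) = x"
proof -
  have "homeomorphism U (\<phi> ` U) \<phi> (inv_into U \<phi>)"
    using assms by (auto simp: smooth_atlas_def)
  then show "continuous_on (\<phi> ` U) (inv_into U \<phi>)" "x \<in> U \<Longrightarrow> inv_into U \<phi> (\<phi> x) = x"
    by (auto simp: homeomorphism_def)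
  show "open U" "open (\<phi> ` U)"
    using assms by (auto simp: smooth_atlas_def)
qed

lemma smooth_functionsD:
  "f \<in> smooth_functions G \<Longrightarrow> (U, \<phi>) \<in> atlas G \<Longrightarrow> smooth_on (\<phi> ` U) (\<lambda>y. f (inv_into U \<phi> y))"
  by (auto simp: smooth_functions_def o_def)

lemma smooth_functionsI:
  assumes "\<And>U \<phi>. (U, \<phi>) \<in> atlas G \<Longrightarrow> smooth_on (\<phi> ` U) (\<lambda>y. f (inv_into U \<phi> y))"
  shows "f \<in> smooth_functions G"
  using assms by (auto simp: smooth_functions_def o_def)

lemma smooth_functions_const: "(\<lambda>x. c) \<in> smooth_functions G"
  by (rule smooth_functionsI) (rule smooth_on_const)

context
  fixes G :: "('g::t2_space, 'e::euclidean_space) lie_group"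
  assumes atl: "smooth_atlas (atlas G)"
begin

lemma smooth_functions_mult:
  "f \<in> smooth_functions G \<Longrightarrow> g \<in> smooth_functions G \<Longrightarrow> (\<lambda>x. f x * g x) \<in> smooth_functions G"
  by (rule smooth_functionsI, rule smooth_on_mult[OF smooth_atlasD(2)[OF atl]])
    (auto intro: smooth_functionsD)

lemma smooth_functions_diff:
  "f \<in> smooth_functions G \<Longrightarrow> g \<in> smooth_functions G \<Longrightarrow> (\<lambda>x. f x - g x) \<in> smooth_functions G"
  by (rule smooth_functionsI, rule smooth_on_diff[OF smooth_atlasD(2)[OF atl]])
    (auto intro: smooth_functionsD)

lemma smooth_functions_sum:
  "(\<And>i. i \<in> I \<Longrightarrow> f i \<in> smooth_functions G) \<Longrightarrow> (\<lambda>x. \<Sum>i\<in>I. f i x) \<in> smooth_functions G"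
  by (rule smooth_functionsI, rule smooth_on_sum[OF smooth_atlasD(2)[OF atl]])
    (auto intro: smooth_functionsD)

lemma diff_operatorsI:
  assumes "\<And>U \<phi>. (U, \<phi>) \<in> atlas G \<Longrightarrow> \<exists>a. (\<forall>vs. smooth_on (\<phi> ` U) (a vs)) \<and>
    (\<forall>f x. f \<in> smooth_functions G \<longrightarrow> x \<in> U \<longrightarrow> P f x =
      (\<Sum>vs\<in>basis_words m. a vs (\<phi> x) * iterated_deriv vs (\<lambda>y. f (inv_into U \<phi> y)) (\<phi> x)))"
  shows "P \<in> diff_operators G m"
proof -
  have "smooth_on (\<phi> ` U) (P f \<circ> inv_into U \<phi>)"
    if U: "(U, \<phi>) \<in> atlas G" and f: "f \<in> smooth_functions G" for U \<phi> f
  proof -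
    note S = smooth_atlasD(2)[OF atl U]
    from assms[OF U] obtain a where a: "\<And>vs. smooth_on (\<phi> ` U) (a vs)"
      "\<And>f x. f \<in> smooth_functions G \<Longrightarrow> x \<in> U \<Longrightarrow> P f x =
        (\<Sum>vs\<in>basis_words m. a vs (\<phi> x) * iterated_deriv vs (\<lambda>y. f (inv_into U \<phi> y)) (\<phi> x))"
      by blast
    show ?thesis
    proof (rule smooth_on_cong[OF S])
      show "smooth_on (\<phi> ` U)
          (\<lambda>z. \<Sum>vs\<in>basis_words m. a vs z * iterated_deriv vs (\<lambda>y. f (inv_into U \<phi> y)) z)"
        by (rule smooth_on_sum[OF S smooth_on_mult[OF S a(1)
              smooth_on_iterated_deriv[OF smooth_functionsD[OF f U]]]])
      show "(\<Sum>vs\<in>basis_words m. a vs z * iterated_deriv vs (\<lambda>y. f (inv_into U \<phi> y)) z) =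
          (P f \<circ> inv_into U \<phi>) z" if "z \<in> \<phi> ` U" for z
        using that a(2)[OF f] by (auto simp: smooth_atlasD(4)[OF atl U])
    qed
  qed
  moreover have "\<exists>a. (\<forall>vs\<in>basis_words m. smooth_on (\<phi> ` U) (a vs)) \<and>
      (\<forall>f\<in>smooth_functions G. \<forall>x\<in>U. P f x =
        (\<Sum>vs\<in>basis_words m. a vs (\<phi> x) * iterated_deriv vs (f \<circ> inv_into U \<phi>) (\<phi> x)))"
    if "(U, \<phi>) \<in> atlas G" for U \<phi>
    using assms[OF that] by (auto simp: o_def)
  ultimately show ?thesis
    unfolding diff_operators_def by (intro CollectI conjI ballI smooth_functionsI) (simp_all add: o_def split_beta)
qed

lemma diff_operatorsD:
  assumes "P \<in> diff_operators G m" "(U, \<phi>) \<in> atlas G"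
  shows "\<exists>a. (\<forall>vs\<in>basis_words m. smooth_on (\<phi> ` U) (a vs)) \<and>
    (\<forall>f\<in>smooth_functions G. \<forall>x\<in>U. P f x =
      (\<Sum>vs\<in>basis_words m. a vs (\<phi> x) * iterated_deriv vs (\<lambda>y. f (inv_into U \<phi> y)) (\<phi> x)))"
  using assms by (auto simp: diff_operators_def o_def dest!: bspec[OF _ assms(2)])

lemma diff_operators_mult:
  assumes P: "P \<in> diff_operators G m" and q: "q \<in> smooth_functions G"
  shows "(\<lambda>f. P (\<lambda>x. q x * f x)) \<in> diff_operators G m"
proof (rule diff_operatorsI)
  fix U \<phi> assume U: "(U, \<phi>) \<in> atlas G"
  note S = smooth_atlasD(2)[OF atl U]
  obtain a where a: "\<And>vs. vs \<in> basis_words m \<Longrightarrow> smooth_on (\<phi> ` U) (a vs)"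
    "\<And>f x. f \<in> smooth_functions G \<Longrightarrow> x \<in> U \<Longrightarrow> P f x =
      (\<Sum>vs\<in>basis_words m. a vs (\<phi> x) * iterated_deriv vs (\<lambda>y. f (inv_into U \<phi> y)) (\<phi> x))"
    using diff_operatorsD[OF P U] by blast
  have "\<forall>vs\<in>basis_words m. \<exists>d. (\<forall>ws. smooth_on (\<phi> ` U) (d ws)) \<and>
      (\<forall>f y. smooth_on (\<phi> ` U) f \<longrightarrow> y \<in> \<phi> ` U \<longrightarrow>
        iterated_deriv vs (\<lambda>x. q (inv_into U \<phi> x) * f x) y =
          (\<Sum>ws\<in>basis_words m. d ws y * iterated_deriv ws f y))"
    by (intro ballI, rule iterated_deriv_mult_comp[OF S S smooth_on_ident _ smooth_functionsD[OF q U]])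
      (simp_all add: basis_words_def)
  from bchoice[OF this] obtain d where d: "\<And>vs ws. vs \<in> basis_words m \<Longrightarrow> smooth_on (\<phi> ` U) (d vs ws)"
    "\<And>vs f y. vs \<in> basis_words m \<Longrightarrow> smooth_on (\<phi> ` U) f \<Longrightarrow> y \<in> \<phi> ` U \<Longrightarrow>
        iterated_deriv vs (\<lambda>x. q (inv_into U \<phi> x) * f x) y =
          (\<Sum>ws\<in>basis_words m. d vs ws y * iterated_deriv ws f y)"
    by blast
  show "\<exists>e. (\<forall>vs. smooth_on (\<phi> ` U) (e vs)) \<and>
    (\<forall>f x. f \<in> smooth_functions G \<longrightarrow> x \<in> U \<longrightarrow> P (\<lambda>x. q x * f x) x =
      (\<Sum>vs\<in>basis_words m. e vs (\<phi> x) * iterated_deriv vs (\<lambda>y. f (inv_into U \<phi> y)) (\<phi> x)))"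
  proof (intro exI[of _ "\<lambda>ws y. \<Sum>vs\<in>basis_words m. a vs y * d vs ws y"] conjI allI impI)
    show "smooth_on (\<phi> ` U) (\<lambda>y. \<Sum>vs\<in>basis_words m. a vs y * d vs ws y)" for ws
      by (rule smooth_on_sum[OF S smooth_on_mult[OF S a(1) d(1)]])
    fix f x assume f: "f \<in> smooth_functions G" and x: "x \<in> U"
    let ?D = "\<lambda>ws. iterated_deriv ws (\<lambda>y. f (inv_into U \<phi> y)) (\<phi> x)"
    have "P (\<lambda>x. q x * f x) x =
        (\<Sum>vs\<in>basis_words m. a vs (\<phi> x) * (\<Sum>ws\<in>basis_words m. d vs ws (\<phi> x) * ?D ws))"
      unfolding a(2)[OF smooth_functions_mult[OF q f] x]
      by (rule sum.cong[OF refl]) (simp add: d(2)[OF _ smooth_functionsD[OF f U]] x)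
    also have "\<dots> = (\<Sum>vs\<in>basis_words m. \<Sum>ws\<in>basis_words m. a vs (\<phi> x) * d vs ws (\<phi> x) * ?D ws)"
      by (simp add: sum_distrib_left mult.assoc)
    also have "\<dots> = (\<Sum>ws\<in>basis_words m. \<Sum>vs\<in>basis_words m. a vs (\<phi> x) * d vs ws (\<phi> x) * ?D ws)"
      by (rule sum.swap)
    finally show "P (\<lambda>x. q x * f x) x =
        (\<Sum>ws\<in>basis_words m. (\<Sum>vs\<in>basis_words m. a vs (\<phi> x) * d vs ws (\<phi> x)) * ?D ws)"
      by (simp add: sum_distrib_right)
  qed
qed

end

lemma mult_in_charts:
  fixes G :: "('g::t2_space, 'e::euclidean_space) lie_group"
  assumes G: "compact_lie_group G" and V: "(V, \<psi>) \<in> atlas G" and U: "(U, \<phi>) \<in> atlas G"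
  defines "W \<equiv> {p. fst p \<in> \<psi> ` V \<and> snd p \<in> \<phi> ` U \<and>
    inv_into V \<psi> (fst p) \<otimes>\<^bsub>G\<^esub> inv_into U \<phi> (snd p) \<in> V}"
  shows "open W"
    and "smooth_on W (\<lambda>p. \<psi> (inv_into V \<psi> (fst p) \<otimes>\<^bsub>G\<^esub> inv_into U \<phi> (snd p)))"
proof -
  let ?mult = "\<lambda>(x, y). x \<otimes>\<^bsub>G\<^esub> y"
  let ?inv = "\<lambda>p. (inv_into V \<psi> (fst p), inv_into U \<phi> (snd p))"
  have atl: "smooth_atlas (atlas G)"
    and sm: "smooth_map (prod_atlas (atlas G) (atlas G)) (atlas G) ?mult"
    using G by (auto simp: compact_lie_group_def)
  note cV = smooth_atlasD[OF atl V] and cU = smooth_atlasD[OF atl U]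
  have "continuous_on UNIV ?mult"
    using sm by (simp add: smooth_map_def)
  then have mult: "open (?mult -` V)"
    using cV(1) by (simp add: open_vimage)
  have inv: "continuous_on (\<psi> ` V \<times> \<phi> ` U) ?inv"
    by (intro continuous_intros continuous_on_compose2[OF cV(3)] continuous_on_compose2[OF cU(3)]) auto
  have "open ((\<psi> ` V \<times> \<phi> ` U) \<inter> ?inv -` (?mult -` V))"
    by (rule continuous_open_preimage[OF inv open_Times[OF cV(2) cU(2)] mult])
  moreover have "(\<psi> ` V \<times> \<phi> ` U) \<inter> ?inv -` (?mult -` V) = W"
    by (auto simp: W_def)
  ultimately show W: "open W" by simp
  have inj: "inj_on (map_prod \<psi> \<phi>) (V \<times> U)"
    by (intro map_prod_inj_on inj_on_inverseI) (rule cV(4) cU(4), assumption)+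
  have prod: "(V \<times> U, map_prod \<psi> \<phi>) \<in> prod_atlas (atlas G) (atlas G)"
    using U V by (auto simp: prod_atlas_def)
  have "\<forall>c\<in>prod_atlas (atlas G) (atlas G). \<forall>d\<in>atlas G.
      smooth_on (snd c ` (fst c \<inter> ?mult -` fst d)) (snd d \<circ> ?mult \<circ> inv_into (fst c) (snd c))"
    using sm by (simp add: smooth_map_def split_beta)
  from bspec[OF bspec[OF this prod] V]
  have "smooth_on (map_prod \<psi> \<phi> ` (V \<times> U \<inter> ?mult -` V))
      (\<psi> \<circ> ?mult \<circ> inv_into (V \<times> U) (map_prod \<psi> \<phi>))"
    unfolding fst_conv snd_conv .
  moreover have "map_prod \<psi> \<phi> ` (V \<times> U \<inter> ?mult -` V) = W"
  proof (intro equalityI subsetI)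
    fix p assume "p \<in> W"
    then obtain x y where "x \<in> V" "y \<in> U" "p = map_prod \<psi> \<phi> (x, y)" "x \<otimes>\<^bsub>G\<^esub> y \<in> V"
      by (cases p) (auto simp: W_def cV(4) cU(4))
    then show "p \<in> map_prod \<psi> \<phi> ` (V \<times> U \<inter> ?mult -` V)"
      by (intro image_eqI[of _ _ "(x, y)"]) simp_all
  qed (auto simp: W_def cV(4) cU(4))
  ultimately have "smooth_on W (\<psi> \<circ> ?mult \<circ> inv_into (V \<times> U) (map_prod \<psi> \<phi>))"
    by simp
  then show "smooth_on W (\<lambda>p. \<psi> (inv_into V \<psi> (fst p) \<otimes>\<^bsub>G\<^esub> inv_into U \<phi> (snd p)))"
  proof (rule smooth_on_cong[OF W, rotated])
    fix p assume "p \<in> W"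
    then obtain x y where xy: "x \<in> V" "y \<in> U" "p = map_prod \<psi> \<phi> (x, y)"
      by (cases p) (auto simp: W_def)
    then have "inv_into (V \<times> U) (map_prod \<psi> \<phi>) p = (x, y)"
      using inv_into_f_f[OF inj, of "(x, y)"] by simp
    then show "(\<psi> \<circ> ?mult \<circ> inv_into (V \<times> U) (map_prod \<psi> \<phi>)) p =
        \<psi> (inv_into V \<psi> (fst p) \<otimes>\<^bsub>G\<^esub> inv_into U \<phi> (snd p))"
      using xy cV(4) cU(4) by simp
  qed
qed

lemma translated_iterated_deriv_left_invariant:
  fixes G :: "('g::t2_space, 'e::euclidean_space) lie_group"
  assumes G: "compact_lie_group G" and U: "(U, \<phi>) \<in> atlas G" and e: "\<one>\<^bsub>G\<^esub> \<in> U"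
    and len: "length vs \<le> m"
  shows "(\<lambda>f x. iterated_deriv vs (\<lambda>y. f (x \<otimes>\<^bsub>G\<^esub> inv_into U \<phi> y)) (\<phi> \<one>\<^bsub>G\<^esub>))
    \<in> left_invariant_diff_operators G m"
proof -
  have atl: "smooth_atlas (atlas G)" and group: "group G" and carrier: "carrier G = UNIV"
    using G by (auto simp: compact_lie_group_def)
  interpret group G by (rule group)
  have "(\<lambda>f x. iterated_deriv vs (\<lambda>y. f (x \<otimes>\<^bsub>G\<^esub> inv_into U \<phi> y)) (\<phi> \<one>\<^bsub>G\<^esub>)) \<in> diff_operators G m"
  proof (rule diff_operatorsI[OF atl])
    fix V \<psi> assume V: "(V, \<psi>) \<in> atlas G"
    note cV = smooth_atlasD[OF atl V] and cU = smooth_atlasD[OF atl U]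
    define W where "W = {p. fst p \<in> \<psi> ` V \<and> snd p \<in> \<phi> ` U \<and>
      inv_into V \<psi> (fst p) \<otimes>\<^bsub>G\<^esub> inv_into U \<phi> (snd p) \<in> V}"
    define \<mu> where "\<mu> = (\<lambda>p. \<psi> (inv_into V \<psi> (fst p) \<otimes>\<^bsub>G\<^esub> inv_into U \<phi> (snd p)))"
    have W: "open W" and \<mu>: "smooth_on W \<mu>"
      using mult_in_charts[OF G V U] by (simp_all add: W_def \<mu>_def)
    have \<mu>V: "\<mu> ` W \<subseteq> \<psi> ` V"
      by (auto simp: W_def \<mu>_def)
    have "\<exists>a. (\<forall>ws. smooth_on W (a ws)) \<and> (\<forall>f p. smooth_on (\<psi> ` V) f \<longrightarrow> p \<in> W \<longrightarrow>
        iterated_deriv (map (Pair 0) vs) (\<lambda>p. 1 * f (\<mu> p)) p =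
        (\<Sum>ws\<in>basis_words m. a ws p * iterated_deriv ws f (\<mu> p)))"
      by (rule iterated_deriv_mult_comp[OF W cV(2) \<mu> \<mu>V smooth_on_const]) (simp add: len)
    then obtain a where sa: "\<And>ws. smooth_on W (a ws)" and
      a: "\<And>f p. smooth_on (\<psi> ` V) f \<Longrightarrow> p \<in> W \<Longrightarrow> iterated_deriv (map (Pair 0) vs) (\<lambda>p. f (\<mu> p)) p =
        (\<Sum>ws\<in>basis_words m. a ws p * iterated_deriv ws f (\<mu> p))"
      unfolding mult_1_left by blast
    have slice: "(z, \<phi> \<one>\<^bsub>G\<^esub>) \<in> W" "\<mu> (z, \<phi> \<one>\<^bsub>G\<^esub>) = z" if "z \<in> \<psi> ` V" for z
      using that e cV(4) cU(4)[OF e] by (auto simp: W_def \<mu>_def carrier)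
    show "\<exists>c. (\<forall>vs. smooth_on (\<psi> ` V) (c vs)) \<and> (\<forall>f x. f \<in> smooth_functions G \<longrightarrow> x \<in> V \<longrightarrow>
        iterated_deriv vs (\<lambda>y. f (x \<otimes>\<^bsub>G\<^esub> inv_into U \<phi> y)) (\<phi> \<one>\<^bsub>G\<^esub>) =
        (\<Sum>ws\<in>basis_words m. c ws (\<psi> x) * iterated_deriv ws (\<lambda>y. f (inv_into V \<psi> y)) (\<psi> x)))"
    proof (intro exI[of _ "\<lambda>ws z. a ws (z, \<phi> \<one>\<^bsub>G\<^esub>)"] conjI allI impI)
      have "bounded_linear (\<lambda>z::'e. (z, 0::'e))"
        by (intro bounded_linear_Pair bounded_linear_ident bounded_linear_zero)
      from smooth_on_affine[OF cV(2) this, of "(0, \<phi> \<one>\<^bsub>G\<^esub>)"]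
      have "smooth_on (\<psi> ` V) (\<lambda>z. (z, \<phi> \<one>\<^bsub>G\<^esub>))" by simp
      then show "smooth_on (\<psi> ` V) (\<lambda>z. a ws (z, \<phi> \<one>\<^bsub>G\<^esub>))" for ws
        by (rule smooth_on_comp[OF cV(2) W _ _ sa]) (use slice in auto)
      fix f x assume f: "f \<in> smooth_functions G" and x: "x \<in> V"
      let ?F = "\<lambda>z. f (inv_into V \<psi> z)" and ?z = "\<psi> x"
      note F = smooth_functionsD[OF f V]
      have z: "?z \<in> \<psi> ` V" using x by simp
      have "open (Pair ?z -` W)"
        by (rule open_vimage[OF W]) (intro continuous_intros)
      then have "iterated_deriv vs (\<lambda>y. f (x \<otimes>\<^bsub>G\<^esub> inv_into U \<phi> y)) (\<phi> \<one>\<^bsub>G\<^esub>) =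
          iterated_deriv vs (\<lambda>y. ?F (\<mu> (?z, y))) (\<phi> \<one>\<^bsub>G\<^esub>)"
        by (rule iterated_deriv_cong) (use x slice(1)[OF z] cV(4) in \<open>auto simp: W_def \<mu>_def\<close>)
      also have "\<dots> = iterated_deriv (map (Pair 0) vs) (\<lambda>p. ?F (\<mu> p)) (?z, \<phi> \<one>\<^bsub>G\<^esub>)"
        by (rule iterated_deriv_slice[OF W smooth_on_comp[OF W cV(2) \<mu> \<mu>V F] slice(1)[OF z]])
      also have "\<dots> = (\<Sum>ws\<in>basis_words m. a ws (?z, \<phi> \<one>\<^bsub>G\<^esub>) * iterated_deriv ws ?F ?z)"
        using a[OF F slice(1)[OF z]] slice(2)[OF z] by simp
      finally show "iterated_deriv vs (\<lambda>y. f (x \<otimes>\<^bsub>G\<^esub> inv_into U \<phi> y)) (\<phi> \<one>\<^bsub>G\<^esub>) =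
          (\<Sum>ws\<in>basis_words m. a ws (?z, \<phi> \<one>\<^bsub>G\<^esub>) * iterated_deriv ws ?F ?z)" .
    qed
  qed
  then show ?thesis
    by (auto simp: left_invariant_diff_operators_def m_assoc carrier)
qed

lemma vanishes_of_order_imp_flat_at:
  fixes G :: "('g::t2_space, 'e::euclidean_space) lie_group"
  assumes G: "compact_lie_group G" and U: "(U, \<phi>) \<in> atlas G" and e: "\<one>\<^bsub>G\<^esub> \<in> U"
    and van: "vanishes_of_order G k q"
  shows "flat_at k (\<phi> \<one>\<^bsub>G\<^esub>) (\<lambda>y. q (inv_into U \<phi> y))"
proof -
  have "group G" and carrier: "carrier G = UNIV"
    using G by (simp_all add: compact_lie_group_def)
  then have one: "\<one>\<^bsub>G\<^esub> \<otimes>\<^bsub>G\<^esub> x = x" for x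
    using monoid.l_one[OF group.is_monoid, of G x] by simp
  have "iterated_deriv vs (\<lambda>y. q (inv_into U \<phi> y)) (\<phi> \<one>\<^bsub>G\<^esub>) = 0" if "length vs < k" for vs
  proof -
    have "\<forall>P\<in>left_invariant_diff_operators G (length vs). P q \<one>\<^bsub>G\<^esub> = 0"
      using van that by (simp add: vanishes_of_order_def)
    from bspec[OF this translated_iterated_deriv_left_invariant[OF G U e order.refl]]
    show ?thesis by (simp add: one)
  qed
  then show ?thesis
    by (simp add: flat_at_def)
qed

lemma flat_at_imp_vanishes_of_order:
  fixes G :: "('g::t2_space, 'e::euclidean_space) lie_group"
  assumes atl: "smooth_atlas (atlas G)" and U: "(U, \<phi>) \<in> atlas G" and e: "\<one>\<^bsub>G\<^esub> \<in> U"
    and q: "q \<in> smooth_functions G" and flat: "flat_at k (\<phi> \<one>\<^bsub>G\<^esub>) (\<lambda>y. q (inv_into U \<phi> y))"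
  shows "vanishes_of_order G k q"
proof -
  have "P q \<one>\<^bsub>G\<^esub> = 0" if m: "m < k" and P: "P \<in> left_invariant_diff_operators G m" for m P
  proof -
    have "P \<in> diff_operators G m"
      using P by (simp add: left_invariant_diff_operators_def)
    from diff_operatorsD[OF atl this U] obtain a where
      a: "\<forall>f\<in>smooth_functions G. \<forall>x\<in>U. P f x =
        (\<Sum>vs\<in>basis_words m. a vs (\<phi> x) * iterated_deriv vs (\<lambda>y. f (inv_into U \<phi> y)) (\<phi> x))"
      by (elim exE conjE)
    have "P q \<one>\<^bsub>G\<^esub> = (\<Sum>vs\<in>basis_words m. a vs (\<phi> \<one>\<^bsub>G\<^esub>) *
        iterated_deriv vs (\<lambda>y. q (inv_into U \<phi> y)) (\<phi> \<one>\<^bsub>G\<^esub>))"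
      by (rule bspec[OF bspec[OF a q] e])
    also have "\<dots> = 0"
      using flat m by (intro sum.neutral) (auto simp: flat_at_def basis_words_def)
    finally show ?thesis .
  qed
  then show ?thesis
    using q by (simp add: vanishes_of_order_def)
qed

section \<open>Difference operators\<close>

lemma coordinates_in_span_of_independent_functionals:
  fixes D :: "nat \<Rightarrow> 'e::euclidean_space \<Rightarrow> complex"
  assumes lin: "\<And>j. j < DIM('e) \<Longrightarrow> linear (D j)"
    and dim: "vector_space.dim (\<lambda>(a::complex) f v. a * f v) (D ` {..<DIM('e)}) = DIM('e)"
    and b: "b \<in> Basis"
  shows "\<exists>\<beta>. \<forall>v. complex_of_real (v \<bullet> b) = (\<Sum>j<DIM('e). \<beta> j * D j v)"
proof -
  let ?n = "DIM('e)" and ?scale = "\<lambda>(a::complex) f (v::'e). a * f v"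
  interpret V: vector_space ?scale
    by unfold_locales (auto simp: fun_eq_iff algebra_simps)
  have sum_apply: "(\<Sum>i\<in>I. F i) v = (\<Sum>i\<in>I. F i v)" for I :: "'i set" and F :: "'i \<Rightarrow> 'e \<Rightarrow> complex" and v
    by (induction I rule: infinite_finite_induct) auto
  let ?S = "D ` {..<?n}"
  obtain B where B: "B \<subseteq> ?S" "V.independent B" "card B = ?n"
    using V.basis_exists[of ?S] dim by metis
  have card: "card ?S \<le> ?n"
    using card_image_le[of "{..<?n}" D] by simp
  have "B = ?S"
    using card_seteq[OF _ B(1)] B(3) card by simp
  then have ind: "V.independent ?S" and cardS: "card ?S = ?n"
    using B by auto
  have inj: "inj_on D {..<?n}"
    using cardS by (intro eq_card_imp_inj_on) simp_all
  let ?coord = "\<lambda>b (v::'e). complex_of_real (v \<bullet> b)"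
  have "D j \<in> V.span (?coord ` Basis)" if "j < ?n" for j
  proof -
    have "D j v = (\<Sum>b\<in>Basis. ?scale (D j b) (?coord b)) v" for v
    proof -
      have "D j v = D j (\<Sum>b\<in>Basis. (v \<bullet> b) *\<^sub>R b)"
        by (simp add: euclidean_representation)
      also have "\<dots> = (\<Sum>b\<in>Basis. D j b * ?coord b v)"
        using lin[OF that] by (simp add: linear_sum linear_scale scaleR_conv_of_real mult.commute)
      finally show ?thesis by (simp add: sum_apply)
    qed
    then have "D j = (\<Sum>b\<in>Basis. ?scale (D j b) (?coord b))" ..
    also have "\<dots> \<in> V.span (?coord ` Basis)"
      by (intro V.span_sum V.span_scale V.span_base) simp
    finally show ?thesis .
  qed
  then have sub: "?S \<subseteq> V.span (?coord ` Basis)" by auto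
  have "?coord b \<in> V.span ?S"
  proof (rule ccontr)
    assume notin: "?coord b \<notin> V.span ?S"
    then have "V.independent (insert (?coord b) ?S)"
      using ind by (rule V.independent_insertI)
    moreover have "insert (?coord b) ?S \<subseteq> V.span (?coord ` Basis)"
      using sub b by (simp add: V.span_base)
    ultimately have "card (insert (?coord b) ?S) \<le> card (?coord ` Basis)"
      using V.independent_span_bound[of "?coord ` Basis" "insert (?coord b) ?S"] by simp
    also have "\<dots> \<le> ?n"
      by (rule card_image_le) simp
    finally show False
      using cardS notin V.span_base[of "?coord b" ?S] by (simp add: card_insert_if split: if_splits)
  qed
  then obtain u where u: "?coord b = (\<Sum>f\<in>?S. ?scale (u f) f)"
    unfolding V.span_finite[of ?S, OF finite_imageI[OF finite_lessThan]] by auto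
  have "?coord b v = (\<Sum>j<?n. u (D j) * D j v)" for v
    using fun_cong[OF u, of v] by (simp add: sum_apply sum.reindex[OF inj])
  then show ?thesis
    by (intro exI[of _ "\<lambda>j. u (D j)"] allI)
qed

lemma distributions_linear:
  assumes "u \<in> distributions G"
  shows "u (\<lambda>x. a * f x + b * g x) = a * u f + b * u g"
  using assms by (simp add: distributions_def)

lemma distributions_sum:
  assumes "u \<in> distributions G" "finite I"
  shows "u (\<lambda>x. \<Sum>i\<in>I. c i * f i x) = (\<Sum>i\<in>I. c i * u (f i))"
  using assms(2)
proof induction
  case empty
  show ?case using distributions_linear[OF assms(1), of 0 "\<lambda>_. 0" 0 "\<lambda>_. 0"] by simp
next
  case (insert i I)
  then show ?case
    using distributions_linear[OF assms(1), of "c i" "f i" 1 "\<lambda>x. \<Sum>i\<in>I. c i * f i x"] by simp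
qed

lemma mult_distribution_in_distributions:
  fixes G :: "('g::t2_space, 'e::euclidean_space) lie_group"
  assumes atl: "smooth_atlas (atlas G)" and q: "q \<in> smooth_functions G" and u: "u \<in> distributions G"
  shows "mult_distribution q u \<in> distributions G"
proof -
  obtain Ps C where Ps: "set Ps \<subseteq> (\<Union>m. diff_operators G m)"
    and bound: "\<And>f. f \<in> smooth_functions G \<Longrightarrow> norm (u f) \<le> C * (\<Sum>P\<leftarrow>Ps. SUP x. norm (P f x))"
    using u unfolding distributions_def by blast
  let ?Ps = "map (\<lambda>P f. P (\<lambda>x. q x * f x)) Ps"
  have "set ?Ps \<subseteq> (\<Union>m. diff_operators G m)"
    using Ps diff_operators_mult[OF atl _ q] by fastforce
  moreover have "norm (mult_distribution q u f) \<le> C * (\<Sum>P\<leftarrow>?Ps. SUP x. norm (P f x))"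
    if "f \<in> smooth_functions G" for f
    using bound[OF smooth_functions_mult[OF atl q that]] by (simp add: mult_distribution_def o_def)
  moreover have "mult_distribution q u (\<lambda>x. a * f x + b * g x) =
      a * mult_distribution q u f + b * mult_distribution q u g" for a b f g
    using distributions_linear[OF u, of a "\<lambda>x. q x * f x" b "\<lambda>x. q x * g x"]
    by (simp add: mult_distribution_def algebra_simps)
  ultimately show ?thesis
    unfolding distributions_def by blast
qed

lemma mult_distribution_mult_distribution:
  "mult_distribution f (mult_distribution g u) = mult_distribution (\<lambda>x. f x * g x) u"
  by (simp add: mult_distribution_def fun_eq_iff mult.assoc mult.left_commute)

lemma smooth_functions_power:
  fixes G :: "('g::t2_space, 'e::euclidean_space) lie_group"
  assumes "smooth_atlas (atlas G)" "f \<in> smooth_functions G"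
  shows "(\<lambda>x. f x ^ k) \<in> smooth_functions G"
  by (rule smooth_functionsI)
    (rule smooth_on_power[OF smooth_atlasD(2)[OF assms(1)] smooth_functionsD[OF assms(2)]])

lemma smooth_functions_prod:
  fixes G :: "('g::t2_space, 'e::euclidean_space) lie_group"
  assumes "smooth_atlas (atlas G)" "\<And>i. i \<in> I \<Longrightarrow> f i \<in> smooth_functions G"
  shows "(\<lambda>x. \<Prod>i\<in>I. f i x) \<in> smooth_functions G"
  by (rule smooth_functionsI)
    (rule smooth_on_prod[OF smooth_atlasD(2)[OF assms(1)] smooth_functionsD[OF assms(2)]])

lemma difference_operator_funpow:
  fixes G :: "('g::t2_space, 'e::euclidean_space) lie_group"
  assumes atl: "smooth_atlas (atlas G)" and q: "q \<in> smooth_functions G"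
    and D: "difference_operator G q D"
  shows "difference_operator G (\<lambda>x. q x ^ k) (D ^^ k)"
  unfolding difference_operator_def
proof
  fix u assume u: "u \<in> distributions G"
  show "(D ^^ k) (fourier G u) = fourier G (mult_distribution (\<lambda>x. q x ^ k) u)"
  proof (induction k)
    case 0
    show ?case by (simp add: mult_distribution_def)
  next
    case (Suc k)
    have "mult_distribution (\<lambda>x. q x ^ k) u \<in> distributions G"
      by (rule mult_distribution_in_distributions[OF atl smooth_functions_power[OF atl q] u])
    then show ?case
      using D by (simp add: Suc difference_operator_def mult_distribution_mult_distribution)
  qed
qed

lemma difference_operator_op_power:
  fixes G :: "('g::t2_space, 'e::euclidean_space) lie_group"
  assumes atl: "smooth_atlas (atlas G)"
    and q: "\<And>j. j < n \<Longrightarrow> q j \<in> smooth_functions G"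
    and \<Delta>: "\<And>j. j < n \<Longrightarrow> difference_operator G (q j) (\<Delta> j)"
  shows "difference_operator G (monomial n q \<alpha>) (op_power n \<Delta> \<alpha>)"
  unfolding difference_operator_def
proof
  fix u assume u: "u \<in> distributions G"
  let ?op = "\<lambda>js. foldr (\<lambda>j F. (\<Delta> j ^^ \<alpha> j) \<circ> F) js id"
  have "?op js (fourier G u) = fourier G (mult_distribution (\<lambda>x. \<Prod>j\<in>set js. q j x ^ \<alpha> j) u)"
    if "distinct js" "set js \<subseteq> {..<n}" for js
    using that
  proof (induction js)
    case Nil
    show ?case by (simp add: mult_distribution_def)
  next
    case (Cons j js)
    let ?v = "mult_distribution (\<lambda>x. \<Prod>j\<in>set js. q j x ^ \<alpha> j) u"
    have j: "j < n" using Cons.prems by simp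
    have "(\<lambda>x. \<Prod>j\<in>set js. q j x ^ \<alpha> j) \<in> smooth_functions G"
      by (rule smooth_functions_prod[OF atl smooth_functions_power[OF atl q]]) (use Cons.prems in auto)
    then have "?v \<in> distributions G"
      by (rule mult_distribution_in_distributions[OF atl _ u])
    then have "(\<Delta> j ^^ \<alpha> j) (fourier G ?v) = fourier G (mult_distribution (\<lambda>x. q j x ^ \<alpha> j) ?v)"
      using difference_operator_funpow[OF atl q[OF j] \<Delta>[OF j]] by (simp add: difference_operator_def)
    then show ?case
      using Cons by (simp add: mult_distribution_mult_distribution)
  qed
  from this[of "[0..<n]"]
  show "op_power n \<Delta> \<alpha> (fourier G u) = fourier G (mult_distribution (monomial n q \<alpha>) u)"
    by (simp add: op_power_def monomial_def[abs_def] atLeast0LessThan)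
qed

lemma fourier_entry:
  assumes "\<kappa> \<in> unitary_dual G" "i < rep_dim G (repr \<kappa>)" "j < rep_dim G (repr \<kappa>)"
  shows "fourier G u \<kappa> $$ (i, j) = u (\<lambda>x. mat_adjoint (repr \<kappa> x) $$ (i, j))"
  using assms by (simp add: fourier_def)

lemma fourier_mult_distribution_expansion:
  assumes u: "u \<in> distributions G" and I: "finite I"
    and \<kappa>: "\<kappa> \<in> unitary_dual G" "i < rep_dim G (repr \<kappa>)" "j < rep_dim G (repr \<kappa>)"
  shows "fourier G (mult_distribution (\<lambda>x. f x - (\<Sum>\<alpha>\<in>I. c \<alpha> * g \<alpha> x)) u) \<kappa> $$ (i, j) =
    fourier G (mult_distribution f u) \<kappa> $$ (i, j) -
      (\<Sum>\<alpha>\<in>I. c \<alpha> * fourier G (mult_distribution (g \<alpha>) u) \<kappa> $$ (i, j))"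
proof -
  let ?e = "\<lambda>x. mat_adjoint (repr \<kappa> x) $$ (i, j)"
  have "u (\<lambda>x. (f x - (\<Sum>\<alpha>\<in>I. c \<alpha> * g \<alpha> x)) * ?e x) =
      u (\<lambda>x. 1 * (f x * ?e x) + (- 1) * (\<Sum>\<alpha>\<in>I. c \<alpha> * (g \<alpha> x * ?e x)))"
    by (simp add: left_diff_distrib sum_distrib_right mult.assoc)
  also have "\<dots> = u (\<lambda>x. f x * ?e x) - (\<Sum>\<alpha>\<in>I. c \<alpha> * u (\<lambda>x. g \<alpha> x * ?e x))"
    unfolding distributions_linear[OF u] distributions_sum[OF u I] by simp
  finally show ?thesis
    by (simp add: fourier_entry[OF \<kappa>] mult_distribution_def)
qed

lemma smooth_functions_monomial:
  fixes G :: "('g::t2_space, 'e::euclidean_space) lie_group"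
  assumes atl: "smooth_atlas (atlas G)" and q: "\<And>j. j < n \<Longrightarrow> q j \<in> smooth_functions G"
  shows "monomial n q \<alpha> \<in> smooth_functions G"
  unfolding monomial_def[abs_def]
  by (rule smooth_functions_prod[OF atl smooth_functions_power[OF atl q]]) simp

lemma vanishing_function_expansion:
  fixes G :: "('g::t2_space, 'e::euclidean_space) lie_group"
  assumes G: "compact_lie_group G" and n: "DIM('e) = n"
    and adm: "strongly_admissible G n \<Delta> q" and van: "vanishes_of_order G l f"
  shows "\<exists>c. vanishes_of_order G N
    (\<lambda>x. f x - (\<Sum>\<alpha>\<in>multi_indices n l N. c \<alpha> * monomial n q \<alpha> x))"
proof -
  have atl: "smooth_atlas (atlas G)"
    using G by (simp add: compact_lie_group_def)
  then have "\<one>\<^bsub>G\<^esub> \<in> (\<Union>(U, \<phi>)\<in>atlas G. U)"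
    by (simp add: smooth_atlas_def)
  then obtain U \<phi> where U: "(U, \<phi>) \<in> atlas G" and e: "\<one>\<^bsub>G\<^esub> \<in> U"
    by auto
  let ?p = "\<phi> \<one>\<^bsub>G\<^esub>" and ?S = "\<phi> ` U"
  note S = smooth_atlasD(2)[OF atl U]
  have p: "?p \<in> ?S" using e by simp
  define r where "r j y = q j (inv_into U \<phi> y)" for j y
  have vq: "vanishes_of_order G 1 (q j)" if "j < n" for j
    using adm that by (simp add: strongly_admissible_def)
  then have q: "q j \<in> smooth_functions G" if "j < n" for j
    using that by (simp add: vanishes_of_order_def)
  have f: "f \<in> smooth_functions G"
    using van by (simp add: vanishes_of_order_def)
  have r: "smooth_on ?S (r j)" if "j < n" for j
    using smooth_functionsD[OF q[OF that] U] by (simp add: r_def[abs_def])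
  have r_flat: "flat_at 1 ?p (r j)" if "j < n" for j
    using vanishes_of_order_imp_flat_at[OF G U e vq[OF that]] by (simp add: r_def[abs_def])
  have "\<forall>c\<in>atlas G. \<one>\<^bsub>G\<^esub> \<in> fst c \<longrightarrow> vector_space.dim (\<lambda>(a::complex) f v. a * f v)
          ((\<lambda>j. differential_in c (q j) \<one>\<^bsub>G\<^esub>) ` {..<n}) = n"
    using adm by (simp add: strongly_admissible_def)
  from bspec[OF this U] have dim: "vector_space.dim (\<lambda>(a::complex) f v. a * f v)
      ((\<lambda>j. frechet_derivative (r j) (at ?p)) ` {..<n}) = n"
    using e by (simp add: differential_in_def o_def r_def[abs_def])
  have lin: "linear (frechet_derivative (r j) (at ?p))" if "j < n" for j
    by (rule linear_frechet_derivative[OF smooth_on_differentiable[OF r[OF that] p]])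
  have "\<forall>b\<in>Basis. \<exists>\<beta>. \<forall>v. complex_of_real (v \<bullet> b) = (\<Sum>j<n. \<beta> j * partial v (r j) ?p)"
    using coordinates_in_span_of_independent_functionals[of "\<lambda>j. frechet_derivative (r j) (at ?p)"] lin dim
    by (simp add: n)
  from bchoice[OF this] obtain \<beta> where
    \<beta>: "\<And>b v. b \<in> Basis \<Longrightarrow> complex_of_real (v \<bullet> b) = (\<Sum>j<n. \<beta> b j * partial v (r j) ?p)"
    by blast
  have coord: "flat_at 2 ?p (\<lambda>x. of_real ((x - ?p) \<bullet> b) - (\<Sum>j<n. \<beta> b j * r j x))"
    if b: "b \<in> Basis" for b
  proof -
    have der: "(r j has_derivative frechet_derivative (r j) (at ?p)) (at ?p)" if "j < n" for j
      using smooth_on_differentiable[OF r[OF that] p] by (simp add: frechet_derivative_works)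
    have "((\<lambda>x. complex_of_real ((x - ?p) \<bullet> b) - (\<Sum>j<n. \<beta> b j * r j x)) has_derivative
        (\<lambda>v. of_real (v \<bullet> b) - (\<Sum>j<n. \<beta> b j * partial v (r j) ?p))) (at ?p)"
      by (auto intro!: derivative_eq_intros der)
    then have "frechet_derivative (\<lambda>x. of_real ((x - ?p) \<bullet> b) - (\<Sum>j<n. \<beta> b j * r j x)) (at ?p) =
        (\<lambda>v. of_real (v \<bullet> b) - (\<Sum>j<n. \<beta> b j * partial v (r j) ?p))"
      by (rule frechet_derivative_at[symmetric])
    then show ?thesis
      using r_flat by (simp add: numeral_2_eq_2 flat_at_Suc flat_at_0 \<beta>[OF b, symmetric])
  qed
  obtain c where c: "flat_at N ?p (\<lambda>y. f (inv_into U \<phi> y) -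
      (\<Sum>\<alpha>\<in>multi_indices n l N. c \<alpha> * monomial n r \<alpha> y))"
    using flat_at_expansion[OF S p r r_flat coord smooth_functionsD[OF f U]
        vanishes_of_order_imp_flat_at[OF G U e van]] by blast
  have "(\<lambda>x. f x - (\<Sum>\<alpha>\<in>multi_indices n l N. c \<alpha> * monomial n q \<alpha> x)) \<in> smooth_functions G"
    by (rule smooth_functions_diff[OF atl f smooth_functions_sum[OF atl smooth_functions_mult[OF atl
          smooth_functions_const smooth_functions_monomial[OF atl q]]]])
  then have "vanishes_of_order G N (\<lambda>x. f x - (\<Sum>\<alpha>\<in>multi_indices n l N. c \<alpha> * monomial n q \<alpha> x))"
    by (rule flat_at_imp_vanishes_of_order[OF atl U e]) (use c in \<open>simp add: monomial_def r_def\<close>)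
  then show ?thesis by (rule exI[of _ c])
qed

theorem lemma3p1:
  fixes G :: "('g::t2_space, 'e::euclidean_space) lie_group"
    and n l N :: nat
    and \<Delta> :: "nat \<Rightarrow> 'g dual_field \<Rightarrow> 'g dual_field"
    and q :: "nat \<Rightarrow> 'g \<Rightarrow> complex"
    and Q :: "'g dual_field \<Rightarrow> 'g dual_field"
  assumes "compact_lie_group G" and "DIM('e) = n"
    and "strongly_admissible G n \<Delta> q"
    and "Q \<in> diff_ops G l"
  shows "\<exists>(c :: (nat \<Rightarrow> nat) \<Rightarrow> complex) Q\<^sub>N. Q\<^sub>N \<in> diff_ops G N \<and>
    (\<forall>u\<in>distributions G. \<forall>\<kappa>\<in>unitary_dual G.
       \<forall>i<rep_dim G (repr \<kappa>). \<forall>j<rep_dim G (repr \<kappa>).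
         Q (fourier G u) \<kappa> $$ (i, j) =
           (\<Sum>\<alpha>\<in>multi_indices n l N. c \<alpha> * op_power n \<Delta> \<alpha> (fourier G u) \<kappa> $$ (i, j))
           + Q\<^sub>N (fourier G u) \<kappa> $$ (i, j))"
proof -
  let ?I = "multi_indices n l N"
  have atl: "smooth_atlas (atlas G)"
    using assms(1) by (simp add: compact_lie_group_def)
  obtain f where f: "vanishes_of_order G l f" "difference_operator G f Q"
    using assms(4) by (auto simp: diff_ops_def)
  obtain c where c: "vanishes_of_order G N (\<lambda>x. f x - (\<Sum>\<alpha>\<in>?I. c \<alpha> * monomial n q \<alpha> x))"
    using vanishing_function_expansion[OF assms(1-3) f(1)] by blast
  have q: "q j \<in> smooth_functions G" "difference_operator G (q j) (\<Delta> j)" if "j < n" for j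
    using assms(3) that by (simp_all add: strongly_admissible_def vanishes_of_order_def)
  define R where "R F = (\<lambda>\<kappa>\<in>unitary_dual G. mat (rep_dim G (repr \<kappa>)) (rep_dim G (repr \<kappa>))
    (\<lambda>(i, j). Q F \<kappa> $$ (i, j) - (\<Sum>\<alpha>\<in>?I. c \<alpha> * op_power n \<Delta> \<alpha> F \<kappa> $$ (i, j))))" for F
  have "R (fourier G u) =
      fourier G (mult_distribution (\<lambda>x. f x - (\<Sum>\<alpha>\<in>?I. c \<alpha> * monomial n q \<alpha> x)) u)"
    if u: "u \<in> distributions G" for u
  proof
    fix \<kappa>
    have Qu: "Q (fourier G u) = fourier G (mult_distribution f u)"
      using f(2) u by (simp add: difference_operator_def)
    have op: "op_power n \<Delta> \<alpha> (fourier G u) = fourier G (mult_distribution (monomial n q \<alpha>) u)" for \<alpha>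
      using difference_operator_op_power[OF atl q] u by (simp add: difference_operator_def)
    show "R (fourier G u) \<kappa> =
        fourier G (mult_distribution (\<lambda>x. f x - (\<Sum>\<alpha>\<in>?I. c \<alpha> * monomial n q \<alpha> x)) u) \<kappa>"
    proof (cases "\<kappa> \<in> unitary_dual G")
      case True
      show ?thesis
      proof (rule eq_matI)
        fix i j
        assume "i < dim_row (fourier G (mult_distribution (\<lambda>x. f x - (\<Sum>\<alpha>\<in>?I. c \<alpha> * monomial n q \<alpha> x)) u) \<kappa>)"
          "j < dim_col (fourier G (mult_distribution (\<lambda>x. f x - (\<Sum>\<alpha>\<in>?I. c \<alpha> * monomial n q \<alpha> x)) u) \<kappa>)"
        then have ij: "i < rep_dim G (repr \<kappa>)" "j < rep_dim G (repr \<kappa>)"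
          using True by (simp_all add: fourier_def)
        show "R (fourier G u) \<kappa> $$ (i, j) =
            fourier G (mult_distribution (\<lambda>x. f x - (\<Sum>\<alpha>\<in>?I. c \<alpha> * monomial n q \<alpha> x)) u) \<kappa> $$ (i, j)"
          unfolding fourier_mult_distribution_expansion[OF u finite_multi_indices True ij]
          using True ij by (simp add: R_def Qu op)
      qed (use True in \<open>simp_all add: R_def fourier_def\<close>)
    qed (simp add: R_def fourier_def)
  qed
  then have "R \<in> diff_ops G N"
    using c by (auto simp: diff_ops_def difference_operator_def)
  then show ?thesis
    by (intro exI[of _ c] exI[of _ R]) (simp add: R_def)
qed

end
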